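(* Let $\Omega$ be a bounded Lipschitz domain in $\mathbb{R}^N$, $N\ge2$, let $N'=N/(N-1)$, and let $B$ be an $N$-function. There exist constants $c_1,c_2>0$ depending on $\Omega$ such that for every $u\in W^{1,B}_0(\Omega)$ $$\left(\int_\Omega B^{N'}(c_1|u|)\,dx\right)^{\frac1{N'}}\le c_2\int_\Omega B(|\nabla u|)\,dx,$$ where $B^{N'}(s)=(B(s))^{N'}$.
   Context: $B:[0,\infty)\to[0,\infty)$ is an $N$-function if it is strictly increasing, convex, $\lim_{r\to0}B(r)/r=0$ and $\lim_{r\to\infty}B(r)/r=\infty$; no further growth condition (such as $\Delta_2$) is assumed. Its conjugate is $\widetilde B(s)=\sup_{t>0}(ts-B(t))$. $L_B(\Omega)$ is the linear span of measurable $\xi$ with $\int_\Omega B(|\xi|)\,dx<\infty$, with the Luxemburg norm $\|\xi\|_{L_B}=\inf\{\lambda>0:\int_\Omega B(|\xi|/\lambda)\,dx\le1\}$; $E_B(\Omega)$ is the closure of bounded functions in the $L_B$-norm. $W^{1,B}(\Omega)=\{u\in W^{1,1}(\Omega):u,\nabla u\in L_B(\Omega)\}$, and $W^{1,B}_0(\Omega)$ is the closure of $C_0^\infty(\Omega)$ in $W^{1,B}(\Omega)$ with respect to the topology $\sigma(L_B,E_{\widetilde B})$ (for functions and their gradients). *)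

theory Defs
  imports "HOL-Analysis.Analysis"
begin

text \<open>Only the values on \<open>[0,\<infinity>)\<close> matter. The conditions force \<open>B 0 = 0\<close>.\<close>

definition N_function :: "(real \<Rightarrow> real) \<Rightarrow> bool" where
  "N_function B \<longleftrightarrow>
     (\<forall>r\<ge>0. 0 \<le> B r) \<and> strict_mono_on {0..} B \<and> convex_on {0..} B \<and>
     ((\<lambda>r. B r / r) \<longlongrightarrow> 0) (at_right 0) \<and> filterlim (\<lambda>r. B r / r) at_top at_top"

text \<open>The supremum is finite for \<open>s \<ge> 0\<close> because an N-function grows superlinearly.\<close>

definition conjugate_fun :: "(real \<Rightarrow> real) \<Rightarrow> real \<Rightarrow> real" where
  "conjugate_fun B s = (SUP t\<in>{0<..}. t * s - B t)"

text \<open>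
  Functions on \<open>\<Omega>\<close> are total functions whose values outside \<open>\<Omega>\<close> are irrelevant; they are not
  quotiented by equality almost everywhere.
\<close>

definition orlicz_class :: "(real \<Rightarrow> real) \<Rightarrow> 'a::euclidean_space set \<Rightarrow> ('a \<Rightarrow> real) set" where
  "orlicz_class B \<Omega> = {\<xi> \<in> borel_measurable (lebesgue_on \<Omega>).
     (\<integral>\<^sup>+x. ennreal (B \<bar>\<xi> x\<bar>) \<partial>lebesgue_on \<Omega>) < \<infinity>}"

definition orlicz_space :: "(real \<Rightarrow> real) \<Rightarrow> 'a::euclidean_space set \<Rightarrow> ('a \<Rightarrow> real) set" where
  "orlicz_space B \<Omega> = {\<xi>. \<exists>(n::nat) c f. (\<forall>i<n. f i \<in> orlicz_class B \<Omega>) \<and>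
     \<xi> = (\<lambda>x. \<Sum>i<n. (c i :: real) * f i x)}"

definition luxemburg_norm :: "(real \<Rightarrow> real) \<Rightarrow> 'a::euclidean_space set \<Rightarrow> ('a \<Rightarrow> real) \<Rightarrow> real" where
  "luxemburg_norm B \<Omega> \<xi> =
     Inf {l. 0 < l \<and> (\<integral>\<^sup>+x. ennreal (B (\<bar>\<xi> x\<bar> / l)) \<partial>lebesgue_on \<Omega>) \<le> 1}"

definition E_space :: "(real \<Rightarrow> real) \<Rightarrow> 'a::euclidean_space set \<Rightarrow> ('a \<Rightarrow> real) set" where
  "E_space B \<Omega> = {\<xi> \<in> orlicz_space B \<Omega>. \<forall>\<epsilon>>0. \<exists>f \<in> orlicz_space B \<Omega>.
     bounded (f ` \<Omega>) \<and> luxemburg_norm B \<Omega> (\<lambda>x. \<xi> x - f x) < \<epsilon>}"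

fun C_k :: "nat \<Rightarrow> ('a::euclidean_space \<Rightarrow> real) \<Rightarrow> bool" where
  "C_k 0 f \<longleftrightarrow> continuous_on UNIV f"
| "C_k (Suc k) f \<longleftrightarrow> (\<forall>x. f differentiable (at x)) \<and>
     (\<forall>b\<in>Basis. C_k k (\<lambda>x. frechet_derivative f (at x) b))"

text \<open>Smooth functions with compact support in \<open>\<Omega>\<close>, extended by zero to the whole space.\<close>

definition test_functions :: "'a::euclidean_space set \<Rightarrow> ('a \<Rightarrow> real) set" where
  "test_functions \<Omega> = {\<phi>. (\<forall>k. C_k k \<phi>) \<and>
     compact (closure {x. \<phi> x \<noteq> 0}) \<and> closure {x. \<phi> x \<noteq> 0} \<subseteq> \<Omega>}"

text \<open>Weak gradients, required to be integrable since they are only used for \<open>W\<^sup>1\<^sup>,\<^sup>1\<close>.\<close>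

definition has_weak_gradient ::
    "'a::euclidean_space set \<Rightarrow> ('a \<Rightarrow> real) \<Rightarrow> ('a \<Rightarrow> 'a) \<Rightarrow> bool" where
  "has_weak_gradient \<Omega> u g \<longleftrightarrow> integrable (lebesgue_on \<Omega>) g \<and>
     (\<forall>\<phi>\<in>test_functions \<Omega>. \<forall>b\<in>Basis.
        (LINT x|lebesgue_on \<Omega>. u x * frechet_derivative \<phi> (at x) b)
        = - (LINT x|lebesgue_on \<Omega>. (g x \<bullet> b) * \<phi> x))"

definition W11 :: "'a::euclidean_space set \<Rightarrow> ('a \<Rightarrow> real) set" where
  "W11 \<Omega> = {u. integrable (lebesgue_on \<Omega>) u \<and> (\<exists>g. has_weak_gradient \<Omega> u g)}"

text \<open>The weak gradient is unique up to null sets; an arbitrary representative is chosen.\<close>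

definition weak_grad :: "'a::euclidean_space set \<Rightarrow> ('a \<Rightarrow> real) \<Rightarrow> 'a \<Rightarrow> 'a" where
  "weak_grad \<Omega> u = (SOME g. has_weak_gradient \<Omega> u g)"

definition W1B :: "(real \<Rightarrow> real) \<Rightarrow> 'a::euclidean_space set \<Rightarrow> ('a \<Rightarrow> real) set" where
  "W1B B \<Omega> = {u \<in> W11 \<Omega>. u \<in> orlicz_space B \<Omega> \<and>
     (\<forall>b\<in>Basis. (\<lambda>x. weak_grad \<Omega> u x \<bullet> b) \<in> orlicz_space B \<Omega>)}"

text \<open>
  The topology \<open>\<sigma>(L\<^sub>B, E)\<close>, with \<open>E\<close> the E-space of the conjugate function, for functions and
  their gradients: the coarsest topology on \<open>W1B\<close> making \<open>u \<mapsto> \<integral> u w\<close> and all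
  \<open>u \<mapsto> \<integral> (\<partial>\<^sub>b u) w\<close> continuous, for \<open>w\<close> in \<open>E\<close>.
\<close>

definition W1B_weak_topology ::
    "(real \<Rightarrow> real) \<Rightarrow> 'a::euclidean_space set \<Rightarrow> ('a \<Rightarrow> real) topology" where
  "W1B_weak_topology B \<Omega> = topology_generated_by
     ({{u \<in> W1B B \<Omega>. (LINT x|lebesgue_on \<Omega>. u x * w x) \<in> U} | w U.
         w \<in> E_space (conjugate_fun B) \<Omega> \<and> open U} \<union>
      {{u \<in> W1B B \<Omega>. (LINT x|lebesgue_on \<Omega>. (weak_grad \<Omega> u x \<bullet> b) * w x) \<in> U} | b w U.
         b \<in> Basis \<and> w \<in> E_space (conjugate_fun B) \<Omega> \<and> open U})"

definition W1B_0 :: "(real \<Rightarrow> real) \<Rightarrow> 'a::euclidean_space set \<Rightarrow> ('a \<Rightarrow> real) set" where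
  "W1B_0 B \<Omega> = W1B_weak_topology B \<Omega> closure_of test_functions \<Omega>"

text \<open>
  Near each boundary point \<open>\<Omega>\<close> is the strict epigraph of a Lipschitz function in suitable
  orthonormal coordinates: the unit vector \<open>e\<close> is the vertical axis, and \<open>x - (x \<bullet> e) *\<^sub>R e\<close> is
  the projection of \<open>x\<close> to the hyperplane orthogonal to \<open>e\<close>.
\<close>

definition lipschitz_domain :: "'a::euclidean_space set \<Rightarrow> bool" where
  "lipschitz_domain \<Omega> \<longleftrightarrow> open \<Omega> \<and> connected \<Omega> \<and> \<Omega> \<noteq> {} \<and>
     (\<forall>p\<in>frontier \<Omega>. \<exists>r>0. \<exists>e. \<exists>\<gamma>::'a \<Rightarrow> real. \<exists>L. norm e = 1 \<and>
        lipschitz_on L {y. y \<bullet> e = 0} \<gamma> \<and>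
        \<Omega> \<inter> ball p r = {x \<in> ball p r. \<gamma> (x - (x \<bullet> e) *\<^sub>R e) < x \<bullet> e})"

text \<open>Powers with positive real exponent of extended nonnegative reals.\<close>

definition ennreal_powr :: "ennreal \<Rightarrow> real \<Rightarrow> ennreal" where
  "ennreal_powr x p = (if x = \<infinity> then \<infinity> else ennreal (enn2real x powr p))"

end

theory Submission
  imports Defs "HOL-Probability.Probability_Measure"
begin

text \<open>
  The constants are \<open>c\<^sub>1 = c\<^sub>2 = 1 / d\<close> for any \<open>d\<close> larger than the diameter of \<open>\<Omega>\<close>. Neither the
  derivative of \<open>B\<close> nor its conjugate enters the estimate, so no growth condition is needed and the
  constants do not depend on \<open>B\<close>.

  For a test function \<open>\<phi>\<close>, a coordinate vector \<open>b\<close> and \<open>x \<in> \<Omega>\<close>, the point \<open>x + d b\<close> lies outside \<open>\<Omega>\<close>,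
  hence \<open>\<phi> x = - \<integral>\<^sub>0\<^sup>d \<partial>\<^sub>b\<phi> (x + t b) dt\<close>. Tested against a bounded function \<open>w\<close> supported in \<open>\<Omega>\<close>,
  this reads \<open>\<integral> \<phi> w = - \<integral> \<partial>\<^sub>b\<phi> W\<close> with \<open>W y = \<integral>\<^sub>0\<^sup>d w (y - t b) dt\<close> by Fubini's theorem. As \<open>w\<close> and
  \<open>W\<close> are bounded, they belong to the space \<open>E\<close> of the conjugate function, both sides are continuous
  in \<open>\<sigma>(L\<^sub>B, E)\<close>, and the identity passes to every \<open>u\<close> in the closure
  (\<open>W1B_0_linear_identity\<close>). So \<open>u x = - \<integral>\<^sub>0\<^sup>d \<partial>\<^sub>bu (x + t b) dt\<close> for almost every \<open>x \<in> \<Omega>\<close>, with the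
  gradient extended by zero (\<open>W1B_0_segment_representation\<close>). That the weak gradient of a test function
  is its classical gradient follows from the fundamental lemma of the calculus of variations.

  Jensen's inequality (\<open>Jensen_segment\<close>) turns the representation into
  \<open>B (\<bar>u x\<bar> / d) \<le> 1/d \<integral> B (\<bar>\<nabla>u (x + t b)\<bar>) dt\<close>, with the integral over the whole line, for each of the
  \<open>N\<close> coordinate vectors \<open>b\<close>. Multiplying these \<open>N\<close> bounds, each raised to the power \<open>1/(N-1)\<close>, and
  integrating by the Gagliardo-Nirenberg argument (\<open>Gagliardo_inequality\<close>) gives
  \<open>\<integral> B (\<bar>u\<bar> / d)\<^sup>N\<^sup>' \<le> (1/d \<integral> B (\<bar>\<nabla>u\<bar>))\<^sup>N\<^sup>'\<close>.
\<close>

section \<open>Smooth functions and bump functions\<close>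

lemma frechet_derivative_eqI:
  "(f has_derivative D) (at x) \<Longrightarrow> frechet_derivative f (at x) = D"
  by (metis frechet_derivative_at)

lemma C_k_SucD: "C_k (Suc k) f \<Longrightarrow> C_k k f"
proof (induction k arbitrary: f)
  case 0
  then show ?case
    by (auto simp: continuous_on_eq_continuous_at intro: differentiable_imp_continuous_within)
next
  case (Suc k)
  have "C_k (Suc k) (\<lambda>x. frechet_derivative f (at x) b)" if "b \<in> Basis" for b
    using Suc.prems that by (subst (asm) C_k.simps) blast
  with Suc show ?case
    by (subst C_k.simps) (meson C_k.simps(2))
qed

lemma C_k_const: "C_k k (\<lambda>x::'a::euclidean_space. c)"
proof (induction k arbitrary: c)
  case (Suc k)
  have "frechet_derivative (\<lambda>x::'a. c) (at x) b = 0" for x b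
    by (subst frechet_derivative_eqI[of _ "\<lambda>h. 0"]) auto
  then show ?case using Suc by simp
qed simp

lemma C_k_add:
  fixes f g :: "'a::euclidean_space \<Rightarrow> real"
  shows "C_k k f \<Longrightarrow> C_k k g \<Longrightarrow> C_k k (\<lambda>x. f x + g x)"
proof (induction k arbitrary: f g)
  case 0
  then show ?case by (simp add: continuous_on_add)
next
  case (Suc k)
  have d: "f differentiable at x" "g differentiable at x" for x
    using Suc.prems by auto
  have "frechet_derivative (\<lambda>x. f x + g x) (at x) b =
     frechet_derivative f (at x) b + frechet_derivative g (at x) b" for x b
    by (subst frechet_derivative_eqI[OF has_derivative_add])
      (use d frechet_derivative_works in blast)+
  then show ?case using Suc by (auto simp: d)
qed

lemma C_k_mult:
  fixes f g :: "'a::euclidean_space \<Rightarrow> real"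
  shows "C_k k f \<Longrightarrow> C_k k g \<Longrightarrow> C_k k (\<lambda>x. f x * g x)"
proof (induction k arbitrary: f g)
  case 0
  then show ?case by (simp add: continuous_on_mult)
next
  case (Suc k)
  have d: "f differentiable at x" "g differentiable at x" for x
    using Suc.prems by auto
  have eq: "frechet_derivative (\<lambda>x. f x * g x) (at x) b =
     f x * frechet_derivative g (at x) b + frechet_derivative f (at x) b * g x" for x b
    by (subst frechet_derivative_eqI[OF has_derivative_mult])
      (use d frechet_derivative_works in blast)+
  have "C_k k f" "C_k k g"
    using Suc.prems by (blast intro: C_k_SucD)+
  moreover have "C_k k (\<lambda>x. frechet_derivative f (at x) b)"
     "C_k k (\<lambda>x. frechet_derivative g (at x) b)" if "b \<in> Basis" for b
    using Suc.prems that by auto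
  ultimately show ?case using Suc.IH by (auto simp: d eq intro!: C_k_add)
qed

lemma C_k_prod:
  fixes f :: "'i \<Rightarrow> 'a::euclidean_space \<Rightarrow> real"
  assumes "\<And>i. i \<in> I \<Longrightarrow> C_k k (f i)"
  shows "C_k k (\<lambda>x. \<Prod>i\<in>I. f i x)"
  using assms by (induction I rule: infinite_finite_induct) (auto intro: C_k_const C_k_mult)

text \<open>
  The functions \<open>exp (- 1 / x) / x ^ m\<close>, extended by \<open>0\<close> to \<open>x \<le> 0\<close>. Keeping the exponent \<open>m\<close> as a
  parameter makes the family closed under differentiation up to linear combinations.
\<close>

definition flat_exp :: "nat \<Rightarrow> real \<Rightarrow> real" where
  "flat_exp m x = (if x > 0 then exp (- (1 / x)) / x ^ m else 0)"

lemma flat_exp_0_le_1: "0 \<le> flat_exp 0 x" "flat_exp 0 x \<le> 1"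
  by (auto simp: flat_exp_def)

lemma flat_exp_tendsto_0: "(flat_exp m \<longlongrightarrow> 0) (at 0)"
proof -
  have "((\<lambda>x::real. x ^ m / exp x) \<longlongrightarrow> 0) at_top"
    by (rule tendsto_power_div_exp_0)
  from filterlim_compose[OF this filterlim_inverse_at_top_right]
  have "((\<lambda>x::real. inverse x ^ m / exp (inverse x)) \<longlongrightarrow> 0) (at_right 0)" .
  then have "(flat_exp m \<longlongrightarrow> 0) (at_right 0)"
  proof (rule Lim_transform_eventually)
    show "\<forall>\<^sub>F x in at_right 0. inverse x ^ m / exp (inverse x) = flat_exp m x"
      by (rule eventually_at_rightI[of 0 1])
        (auto simp: flat_exp_def exp_minus field_simps)
  qed
  moreover have "(flat_exp m \<longlongrightarrow> 0) (at_left 0)"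
  proof (rule Lim_transform_eventually[OF tendsto_const])
    show "\<forall>\<^sub>F x in at_left 0. 0 = flat_exp m x"
      by (rule eventually_at_leftI[of "-1" 0]) (auto simp: flat_exp_def)
  qed
  ultimately show ?thesis by (simp add: filterlim_at_split)
qed

lemma flat_exp_deriv:
  "(flat_exp m has_real_derivative (flat_exp (m + 2) x - real m * flat_exp (m + 1) x)) (at x)"
proof -
  consider "x < 0" | "x = 0" | "x > 0" by linarith
  then show ?thesis
  proof cases
    case 1
    have "((\<lambda>x. 0) has_real_derivative 0) (at x)" by simp
    then have "(flat_exp m has_real_derivative 0) (at x)"
      by (rule has_field_derivative_transform_within_open[of _ _ _ "{..<0}"])
        (use 1 in \<open>auto simp: flat_exp_def\<close>)
    then show ?thesis using 1 by (simp add: flat_exp_def)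
  next
    case 2
    have "((\<lambda>h. flat_exp m h / h) \<longlongrightarrow> 0) (at 0)"
    proof (rule Lim_transform_eventually[OF flat_exp_tendsto_0[of "Suc m"]])
      show "\<forall>\<^sub>F h in at 0. flat_exp (Suc m) h = flat_exp m h / h"
        by (auto simp: flat_exp_def eventually_at intro!: exI[of _ 1])
    qed
    then show ?thesis using 2 by (simp add: flat_exp_def DERIV_def)
  next
    case 3
    have "((\<lambda>x. exp (- (1 / x)) / x ^ m) has_real_derivative
       (exp (- (1/x)) * (1 / x^2) * x ^ m - exp (- (1/x)) * (real m * x ^ (m - 1))) / (x ^ m * x ^ m)) (at x)"
      using 3 by (auto intro!: derivative_eq_intros simp: power2_eq_square)
    then have "(flat_exp m has_real_derivative
       (exp (- (1/x)) * (1 / x^2) * x ^ m - exp (- (1/x)) * (real m * x ^ (m - 1))) / (x ^ m * x ^ m)) (at x)"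
      by (rule has_field_derivative_transform_within_open[of _ _ _ "{0<..}"])
        (use 3 in \<open>auto simp: flat_exp_def\<close>)
    moreover have "(exp (- (1/x)) * (1 / x^2) * x ^ m - exp (- (1/x)) * (real m * x ^ (m - 1))) / (x ^ m * x ^ m)
      = flat_exp (m + 2) x - real m * flat_exp (m + 1) x"
      using 3 by (cases m) (auto simp: flat_exp_def field_simps power2_eq_square)
    ultimately show ?thesis by simp
  qed
qed

lemma C_k_flat_exp_affine: "C_k k (\<lambda>x::'a::euclidean_space. flat_exp m (x \<bullet> v - a))"
proof (induction k arbitrary: m)
  case 0
  have "continuous_on UNIV (flat_exp m)"
    using flat_exp_deriv by (metis DERIV_isCont continuous_at_imp_continuous_on)
  then have "continuous_on UNIV (flat_exp m \<circ> (\<lambda>x::'a. x \<bullet> v - a))"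
    by (intro continuous_on_compose) (auto intro!: continuous_intros intro: continuous_on_subset)
  then show ?case by (simp add: o_def)
next
  case (Suc k)
  have der: "((\<lambda>x::'a. flat_exp m (x \<bullet> v - a)) has_derivative
     (\<lambda>h. (h \<bullet> v) * (flat_exp (m + 2) (x \<bullet> v - a) - real m * flat_exp (m + 1) (x \<bullet> v - a)))) (at x)" for x
  proof -
    have "((\<lambda>x::'a. x \<bullet> v - a) has_derivative (\<lambda>h. h \<bullet> v)) (at x)"
      by (auto intro!: derivative_eq_intros)
    from DERIV_compose_FDERIV[OF flat_exp_deriv this] show ?thesis .
  qed
  have eq: "frechet_derivative (\<lambda>x::'a. flat_exp m (x \<bullet> v - a)) (at x) b
     = (b \<bullet> v) * (flat_exp (m + 2) (x \<bullet> v - a) + (- real m) * flat_exp (m + 1) (x \<bullet> v - a))" for x b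
    by (subst frechet_derivative_eqI[OF der]) simp
  have "C_k k (\<lambda>x::'a. (b \<bullet> v) * (flat_exp (m + 2) (x \<bullet> v - a) + (- real m) * flat_exp (m + 1) (x \<bullet> v - a)))" for b
    by (intro C_k_mult C_k_const C_k_add Suc.IH)
  then show ?case
    unfolding C_k.simps eq using der by (blast intro: differentiableI)
qed

text \<open>
  A smooth function that is positive exactly on the open box with corners \<open>a\<close> and \<open>b\<close> when \<open>n > 0\<close>,
  and that tends to the indicator of the box as \<open>n\<close> grows, because \<open>exp (- 1 / (n s))\<close> tends to \<open>1\<close>
  for \<open>s > 0\<close>.
\<close>

definition box_bump :: "nat \<Rightarrow> 'a::euclidean_space \<Rightarrow> 'a \<Rightarrow> 'a \<Rightarrow> real" where
  "box_bump n a b x = (\<Prod>i\<in>Basis. flat_exp 0 (real n * (x \<bullet> i - a \<bullet> i)) * flat_exp 0 (real n * (b \<bullet> i - x \<bullet> i)))"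

lemma C_k_box_bump: "C_k k (box_bump n a b)"
proof -
  have "C_k k (\<lambda>x. flat_exp 0 (real n * (x \<bullet> i - a \<bullet> i)))" for i
    using C_k_flat_exp_affine[of k 0 "real n *\<^sub>R i" "real n * (a \<bullet> i)"]
    by (simp add: right_diff_distrib)
  moreover have "C_k k (\<lambda>x. flat_exp 0 (real n * (b \<bullet> i - x \<bullet> i)))" for i
    using C_k_flat_exp_affine[of k 0 "- real n *\<^sub>R i" "- real n * (b \<bullet> i)"]
    by (simp add: right_diff_distrib)
  ultimately show ?thesis
    unfolding box_bump_def by (intro C_k_prod C_k_mult)
qed

lemma box_bump_nonzero: "box_bump n a b x \<noteq> 0 \<Longrightarrow> x \<in> box a b"
  by (cases "n = 0") (auto simp: box_bump_def mem_box flat_exp_def zero_less_mult_iff split: if_splits)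

lemma box_bump_bounded: "\<bar>box_bump n a b x\<bar> \<le> 1"
  unfolding box_bump_def abs_prod
  by (rule prod_le_1) (auto simp: flat_exp_0_le_1 abs_mult intro!: mult_le_one)

lemma box_bump_tendsto: "(\<lambda>n. box_bump n a b x) \<longlonglongrightarrow> indicator (box a b) x"
proof (cases "x \<in> box a b")
  case True
  have lim: "(\<lambda>n. flat_exp 0 (real n * s)) \<longlonglongrightarrow> 1" if "s > 0" for s :: real
  proof (rule Lim_transform_eventually)
    have "(\<lambda>n. exp (- (inverse s * inverse (real n)))) \<longlonglongrightarrow> exp (- (inverse s * 0))"
      by (intro tendsto_intros lim_inverse_n)
    then show "(\<lambda>n. exp (- (inverse s * inverse (real n)))) \<longlonglongrightarrow> 1" by simp
    show "\<forall>\<^sub>F n in sequentially. exp (- (inverse s * inverse (real n))) = flat_exp 0 (real n * s)"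
      using eventually_gt_at_top[of 0] by eventually_elim (use that in \<open>auto simp: flat_exp_def field_simps\<close>)
  qed
  have "(\<lambda>n. box_bump n a b x) \<longlonglongrightarrow> (\<Prod>i\<in>(Basis::'a set). 1 * 1)"
    unfolding box_bump_def using True by (intro tendsto_prod tendsto_mult lim) (auto simp: mem_box)
  then show ?thesis using True by simp
next
  case False
  then have "box_bump n a b x = 0" for n using box_bump_nonzero by blast
  then show ?thesis using False by simp
qed

lemma box_bump_test_function:
  assumes "cbox a b \<subseteq> \<Omega>"
  shows "box_bump n a b \<in> test_functions \<Omega>"
proof -
  have "closure {x. box_bump n a b x \<noteq> 0} \<subseteq> cbox a b"
    by (rule closure_minimal) (use box_bump_nonzero box_subset_cbox in blast)+
  moreover from this have "compact (closure {x. box_bump n a b x \<noteq> 0})"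
    by (meson bounded_cbox bounded_subset closed_closure compact_eq_bounded_closed)
  ultimately show ?thesis using assms by (auto simp: test_functions_def C_k_box_bump)
qed

section \<open>The fundamental lemma of the calculus of variations\<close>

lemma integral_lebesgue_on_eq_lborel:
  fixes f :: "'a::euclidean_space \<Rightarrow> 'b::{banach, second_countable_topology}"
  assumes "\<Omega> \<in> sets borel" "f \<in> borel_measurable borel" "\<And>x. x \<notin> \<Omega> \<Longrightarrow> f x = 0"
  shows "integral\<^sup>L (lebesgue_on \<Omega>) f = integral\<^sup>L lborel f"
proof -
  have *: "(\<lambda>x. indicator \<Omega> x *\<^sub>R f x) = f"
    using assms(3) by (auto simp: indicator_def)
  have "integral\<^sup>L (lebesgue_on \<Omega>) f = integral\<^sup>L lebesgue f"
    using assms(1) by (subst integral_restrict_space) (auto simp: *)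
  also have "\<dots> = integral\<^sup>L lborel f"
    by (rule integral_completion) (use assms in simp)
  finally show ?thesis .
qed

lemma nn_integral_lebesgue_on_eq_lborel:
  fixes f :: "'a::euclidean_space \<Rightarrow> ennreal"
  assumes "\<Omega> \<in> sets borel" "\<And>x. x \<notin> \<Omega> \<Longrightarrow> f x = 0"
  shows "integral\<^sup>N (lebesgue_on \<Omega>) f = integral\<^sup>N lborel f"
proof -
  have *: "(\<lambda>x. f x * indicator \<Omega> x) = f"
    using assms(2) by (auto simp: indicator_def)
  have "integral\<^sup>N (lebesgue_on \<Omega>) f = integral\<^sup>N lebesgue f"
    using assms(1) by (subst nn_integral_restrict_space) (auto simp: *)
  also have "\<dots> = integral\<^sup>N lborel f"
    by (rule nn_integral_completion)
  finally show ?thesis .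
qed

lemma AE_lebesgue_on_iff_lborel:
  assumes "\<Omega> \<in> sets borel"
  shows "(AE x in lebesgue_on \<Omega>. P x) \<longleftrightarrow> (AE x in lborel. x \<in> \<Omega> \<longrightarrow> P x)"
  using assms by (subst AE_restrict_space_iff) (auto simp: AE_completion_iff)

lemma borel_measurable_lebesgue_onI:
  "f \<in> borel_measurable borel \<Longrightarrow> f \<in> borel_measurable (lebesgue_on \<Omega>)"
  by (intro measurable_restrict_space1 measurable_completion) simp

lemma integrable_lebesgue_on_borel_representative:
  fixes f :: "'a::euclidean_space \<Rightarrow> real"
  assumes \<Omega>: "\<Omega> \<in> sets borel" and f: "integrable (lebesgue_on \<Omega>) f"
  obtains f' where "f' \<in> borel_measurable borel" "integrable lborel f'"
    "\<And>x. x \<notin> \<Omega> \<Longrightarrow> f' x = 0" "AE x in lebesgue_on \<Omega>. f x = f' x"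
proof -
  let ?f = "\<lambda>x. indicator \<Omega> x *\<^sub>R f x"
  have int: "integrable lebesgue ?f"
    using f \<Omega> by (subst (asm) integrable_restrict_space) auto
  then obtain g where g: "g \<in> borel_measurable lborel" "AE x in lborel. ?f x = g x"
    using completion_ex_borel_measurable_real by blast
  define f' where "f' x = indicator \<Omega> x * g x" for x
  have f'_meas: "f' \<in> borel_measurable borel"
    unfolding f'_def using g(1) \<Omega> by auto
  have ae: "AE x in lborel. ?f x = f' x"
    using g(2) by eventually_elim (auto simp: f'_def indicator_def)
  have "integrable lebesgue f'"
    using int by (rule integrable_cong_AE_imp)
      (use f'_meas ae in \<open>auto simp: AE_completion_iff measurable_completion elim: eventually_mono\<close>)
  then have "integrable lborel f'"
    using f'_meas by (simp add: integrable_completion)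
  moreover have "AE x in lebesgue_on \<Omega>. f x = f' x"
    unfolding AE_lebesgue_on_iff_lborel[OF \<Omega>] using ae by eventually_elim auto
  ultimately show ?thesis
    using that f'_meas by (auto simp: f'_def)
qed

lemma enn2real_inj: "a \<noteq> \<infinity> \<Longrightarrow> b \<noteq> \<infinity> \<Longrightarrow> enn2real a = enn2real b \<longleftrightarrow> a = b"
  by (cases a; cases b) auto

text \<open>
  The positive and negative parts of \<open>f\<close> are densities of two finite measures that agree on the
  intersection-stable family of open boxes, which generates the Borel sets.
\<close>

lemma integral_boxes_eq_0_imp_AE_eq_0:
  fixes f :: "'a::euclidean_space \<Rightarrow> real"
  assumes f: "integrable lborel f"
    and boxes: "\<And>a b. (LINT x|lborel. indicator (box a b) x * f x) = 0"
  shows "AE x in lborel. f x = 0"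
proof -
  have [measurable]: "f \<in> borel_measurable borel" using f by auto
  let ?P = "density lborel (\<lambda>x. ennreal (f x))" and ?N = "density lborel (\<lambda>x. ennreal (- f x))"
  have intb: "integrable lborel (\<lambda>x. indicator (box a b) x * f x)" for a b
    using integrable_mult_indicator[of "box a b", OF _ f] by simp
  have fin: "(\<integral>\<^sup>+x. ennreal (f x) * indicator A x \<partial>lborel) < \<infinity>" for A
  proof -
    have "(\<integral>\<^sup>+x. ennreal (f x) * indicator A x \<partial>lborel) \<le> (\<integral>\<^sup>+x. ennreal (norm (f x)) \<partial>lborel)"
      by (intro nn_integral_mono) (auto simp: indicator_def intro: ennreal_leI)
    also have "\<dots> < \<infinity>" using f by (simp add: integrable_iff_bounded)
    finally show ?thesis .
  qed
  have "?P = ?N"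
  proof (rule measure_eqI_generator_eq[where \<Omega> = UNIV and E = "range (\<lambda>(a, b). box a b::'a set)"
        and A = "\<lambda>n. box (- (real n *\<^sub>R One)) (real n *\<^sub>R One)"])
    show "Int_stable (range (\<lambda>(a, b). box a b :: 'a set))"
      by (auto simp: Int_stable_def box_Int_box)
    show "sets ?P = sigma_sets UNIV (range (\<lambda>(a, b). box a b :: 'a set))"
      "sets ?N = sigma_sets UNIV (range (\<lambda>(a, b). box a b :: 'a set))"
      by (simp_all add: borel_eq_box)
    show "(\<Union>n::nat. box (- (real n *\<^sub>R One)) (real n *\<^sub>R One)) = (UNIV::'a set)"
      by (rule UN_box_eq_UNIV)
    show "emeasure ?P (box (- (real n *\<^sub>R One)) (real n *\<^sub>R One)) \<noteq> \<infinity>" for n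
      using fin by (subst emeasure_density) (auto simp: less_top)
    fix X assume "X \<in> range (\<lambda>(a, b). box a b :: 'a set)"
    then obtain a b where X: "X = box a b" by auto
    have "0 = enn2real (\<integral>\<^sup>+x. ennreal (indicator (box a b) x * f x) \<partial>lborel) -
              enn2real (\<integral>\<^sup>+x. ennreal (- (indicator (box a b) x * f x)) \<partial>lborel)"
      using real_lebesgue_integral_def[OF intb] boxes by simp
    moreover have "(\<integral>\<^sup>+x. ennreal (indicator (box a b) x * f x) \<partial>lborel) \<noteq> \<infinity>"
      "(\<integral>\<^sup>+x. ennreal (- (indicator (box a b) x * f x)) \<partial>lborel) \<noteq> \<infinity>"
      using intb by (auto simp: real_integrable_def)
    ultimately have "(\<integral>\<^sup>+x. ennreal (indicator (box a b) x * f x) \<partial>lborel) =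
        (\<integral>\<^sup>+x. ennreal (- (indicator (box a b) x * f x)) \<partial>lborel)"
      by (simp add: enn2real_inj)
    moreover have "ennreal (indicator (box a b) x * f x) = ennreal (f x) * indicator (box a b) x"
      "ennreal (- (indicator (box a b) x * f x)) = ennreal (- f x) * indicator (box a b) x" for x
      by (auto simp: indicator_def)
    ultimately show "emeasure ?P X = emeasure ?N X"
      by (simp add: X emeasure_density)
  qed auto
  then have "AE x in lborel. ennreal (f x) = ennreal (- f x)"
    by (intro sigma_finite_measure.density_unique[OF sigma_finite_lborel]) auto
  then show ?thesis
  proof eventually_elim
    case (elim x)
    then show ?case by (cases "f x \<ge> 0") (auto simp: ennreal_neg ennreal_eq_0_iff)
  qed
qed

text \<open>
  The functions \<open>box_bump\<close> approximate the indicator of each box whose closure lies in \<open>\<Omega>\<close>, so the integral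
  of \<open>f\<close> over such a box vanishes; countably many of these boxes exhaust \<open>\<Omega>\<close>.
\<close>

lemma fundamental_lemma_calculus_of_variations:
  fixes f :: "'a::euclidean_space \<Rightarrow> real"
  assumes \<Omega>: "open \<Omega>" and f: "integrable (lebesgue_on \<Omega>) f"
    and zero: "\<And>\<phi>. \<phi> \<in> test_functions \<Omega> \<Longrightarrow> (LINT x|lebesgue_on \<Omega>. f x * \<phi> x) = 0"
  shows "AE x in lebesgue_on \<Omega>. f x = 0"
proof -
  have \<Omega>b: "\<Omega> \<in> sets borel" using \<Omega> by auto
  obtain g where g: "g \<in> borel_measurable borel" "integrable lborel g"
    "\<And>x. x \<notin> \<Omega> \<Longrightarrow> g x = 0" "AE x in lebesgue_on \<Omega>. f x = g x"
    using integrable_lebesgue_on_borel_representative[OF \<Omega>b f] by blast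
  note [measurable] = g(1)
  have box0: "(LINT x|lborel. indicator (box a b) x * g x) = 0" if ab: "cbox a b \<subseteq> \<Omega>" for a b
  proof -
    have meas[measurable]: "box_bump n a b \<in> borel_measurable borel" for n
      using C_k_box_bump[of 0 n a b] by (auto intro: borel_measurable_continuous_onI)
    have "(LINT x|lborel. g x * box_bump n a b x) = 0" for n
    proof -
      have "(LINT x|lborel. g x * box_bump n a b x) = (LINT x|lebesgue_on \<Omega>. g x * box_bump n a b x)"
        by (rule integral_lebesgue_on_eq_lborel[symmetric]) (use g \<Omega>b in auto)
      also have "\<dots> = (LINT x|lebesgue_on \<Omega>. f x * box_bump n a b x)"
      proof (rule integral_cong_AE)
        show "AE x in lebesgue_on \<Omega>. g x * box_bump n a b x = f x * box_bump n a b x"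
          using g(4) by eventually_elim simp
        show "(\<lambda>x. g x * box_bump n a b x) \<in> borel_measurable (lebesgue_on \<Omega>)"
          by (rule borel_measurable_lebesgue_onI) simp
        show "(\<lambda>x. f x * box_bump n a b x) \<in> borel_measurable (lebesgue_on \<Omega>)"
          using f borel_measurable_lebesgue_onI[OF meas] by (intro borel_measurable_times) auto
      qed
      also have "\<dots> = 0" by (rule zero[OF box_bump_test_function[OF ab]])
      finally show ?thesis .
    qed
    moreover have "(\<lambda>n. LINT x|lborel. g x * box_bump n a b x) \<longlonglongrightarrow> (LINT x|lborel. g x * indicator (box a b) x)"
    proof (rule integral_dominated_convergence[where w = "\<lambda>x. \<bar>g x\<bar>"])
      show "AE x in lborel. norm (g x * box_bump n a b x) \<le> \<bar>g x\<bar>" for n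
        using box_bump_bounded[of n a b] by (auto simp: abs_mult intro!: mult_left_le)
      show "AE x in lborel. (\<lambda>n. g x * box_bump n a b x) \<longlonglongrightarrow> g x * indicator (box a b) x"
        by (auto intro!: tendsto_mult box_bump_tendsto)
    qed (use g in auto)
    ultimately have "(LINT x|lborel. g x * indicator (box a b) x) = 0"
      using LIMSEQ_unique[OF _ tendsto_const] by simp
    then show ?thesis by (simp add: mult.commute)
  qed
  have AE_box: "AE x in lborel. x \<in> box c d \<longrightarrow> g x = 0" if cd: "cbox c d \<subseteq> \<Omega>" for c d
  proof -
    have "AE x in lborel. indicator (box c d) x * g x = 0"
    proof (rule integral_boxes_eq_0_imp_AE_eq_0)
      show "integrable lborel (\<lambda>x. indicator (box c d) x * g x)"
        using integrable_mult_indicator[of "box c d", OF _ g(2)] by simp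
      fix a b
      \<comment> \<open>the trace of an arbitrary box on \<open>box c d\<close> is again a box with closure in \<open>\<Omega>\<close>\<close>
      obtain p q where pq: "box a b \<inter> box c d = box p q" "cbox p q \<subseteq> cbox c d"
      proof -
        define p where "p = (\<Sum>i\<in>Basis. max (a \<bullet> i) (c \<bullet> i) *\<^sub>R i)"
        define q where "q = (\<Sum>i\<in>Basis. min (b \<bullet> i) (d \<bullet> i) *\<^sub>R i)"
        show ?thesis
          by (rule that[of p q]) (auto simp: box_Int_box p_def q_def mem_box)
      qed
      have "(LINT x|lborel. indicator (box a b) x * (indicator (box c d) x * g x)) =
            (LINT x|lborel. indicator (box a b \<inter> box c d) x * g x)"
        by (simp add: indicator_inter_arith mult.assoc)
      also have "\<dots> = 0" unfolding pq(1) using pq(2) cd by (intro box0) auto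
      finally show "(LINT x|lborel. indicator (box a b) x * (indicator (box c d) x * g x)) = 0" .
    qed
    then show ?thesis by eventually_elim (auto simp: indicator_def)
  qed
  have "AE x in lborel. x \<in> \<Omega> \<longrightarrow> g x = 0"
  proof -
    obtain \<D> where D: "countable \<D>" "\<D> \<subseteq> Pow \<Omega>" "\<And>X. X \<in> \<D> \<Longrightarrow> \<exists>a b. X = cbox a b" "\<Union>\<D> = \<Omega>"
      using open_countable_Union_open_cbox[OF \<Omega>] by metis
    have "AE x in lborel. x \<in> X \<longrightarrow> g x = 0" if X: "X \<in> \<D>" for X
    proof -
      obtain c d where cd: "X = cbox c d" using D(3)[OF X] by auto
      \<comment> \<open>the cover consists of closed boxes, whose boundaries are null sets\<close>
      have "cbox c d - box c d \<in> null_sets lebesgue"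
        using negligible_frontier_interval[of c d] by (simp add: negligible_iff_null_sets)
      then have "AE x in lborel. x \<notin> cbox c d - box c d"
        using AE_not_in AE_completion_iff by blast
      moreover have "AE x in lborel. x \<in> box c d \<longrightarrow> g x = 0"
        by (rule AE_box) (use X D cd in auto)
      ultimately show ?thesis unfolding cd by eventually_elim auto
    qed
    then have "AE x in lborel. \<forall>X\<in>\<D>. x \<in> X \<longrightarrow> g x = 0"
      using D(1) by (subst AE_ball_countable) auto
    then show ?thesis by eventually_elim (use D(4) in blast)
  qed
  then show ?thesis
    using g(4) unfolding AE_lebesgue_on_iff_lborel[OF \<Omega>b] by eventually_elim simp
qed

section \<open>Integration along segments\<close>

lemma integrable_bounded_mult:
  fixes f w :: "'a \<Rightarrow> real"
  assumes f: "integrable M f" and w: "w \<in> borel_measurable M" and bdd: "\<And>x. \<bar>w x\<bar> \<le> C"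
  shows "integrable M (\<lambda>x. w x * f x)"
proof (rule Bochner_Integration.integrable_bound)
  show "integrable M (\<lambda>x. C * f x)" using f by simp
  have "\<bar>w x\<bar> * \<bar>f x\<bar> \<le> \<bar>C\<bar> * \<bar>f x\<bar>" for x
    using bdd[of x] by (intro mult_right_mono) auto
  then show "AE x in M. norm (w x * f x) \<le> norm (C * f x)" by (simp add: abs_mult)
  show "(\<lambda>x. w x * f x) \<in> borel_measurable M" using f w by auto
qed

lemma integral_lborel_translate:
  fixes f :: "'a::euclidean_space \<Rightarrow> real"
  assumes "f \<in> borel_measurable borel"
  shows "(LINT x|lborel. f (x + c)) = (LINT x|lborel. f x)"
proof -
  have "(LINT x|lborel. f x) = (LINT x|distr lborel borel ((+) c). f x)"
    by (simp add: lborel_distr_plus)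
  also have "\<dots> = (LINT x|lborel. f (c + x))"
    using assms by (intro integral_distr) auto
  finally show ?thesis by (simp add: add.commute)
qed

lemma nn_integral_lborel_translate:
  fixes f :: "'a::euclidean_space \<Rightarrow> ennreal"
  assumes "f \<in> borel_measurable borel"
  shows "(\<integral>\<^sup>+x. f (x + c) \<partial>lborel) = (\<integral>\<^sup>+x. f x \<partial>lborel)"
proof -
  have "(\<integral>\<^sup>+x. f x \<partial>lborel) = (\<integral>\<^sup>+x. f x \<partial>distr lborel borel ((+) c))"
    by (simp add: lborel_distr_plus)
  also have "\<dots> = (\<integral>\<^sup>+x. f (c + x) \<partial>lborel)"
    using assms by (intro nn_integral_distr) auto
  finally show ?thesis by (simp add: add.commute)
qed

text \<open>
  The integral of \<open>f\<close> along the segment from \<open>x\<close> to \<open>x + d v\<close>, as a Bochner integral; its value is \<open>0\<close> if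
  \<open>f\<close> is not integrable along the segment.
\<close>

definition segment_integral :: "real \<Rightarrow> 'a::euclidean_space \<Rightarrow> ('a \<Rightarrow> real) \<Rightarrow> 'a \<Rightarrow> real" where
  "segment_integral d v f x = (LINT t|lborel. indicator {0..d} t * f (x + t *\<^sub>R v))"

lemma borel_measurable_segment_integral [measurable]:
  assumes [measurable]: "f \<in> borel_measurable borel"
  shows "segment_integral d v f \<in> borel_measurable borel"
  unfolding segment_integral_def by measurable

lemma integrable_pair_segment:
  fixes f :: "'a::euclidean_space \<Rightarrow> real"
  assumes f: "integrable lborel f"
  shows "integrable (lborel \<Otimes>\<^sub>M lborel) (\<lambda>(t, x). indicator {0..d::real} t * f (x + t *\<^sub>R v))"
proof -
  have [measurable]: "f \<in> borel_measurable borel" using f by auto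
  have "(\<integral>\<^sup>+z. ennreal (norm (case z of (t, x) \<Rightarrow> indicator {0..d} t * f (x + t *\<^sub>R v))) \<partial>(lborel \<Otimes>\<^sub>M lborel))
    = (\<integral>\<^sup>+t. (\<integral>\<^sup>+x. indicator {0..d} t * ennreal \<bar>f (x + t *\<^sub>R v)\<bar> \<partial>lborel) \<partial>lborel)"
    by (subst lborel.nn_integral_fst[symmetric])
      (auto simp: case_prod_beta abs_mult ennreal_mult' ennreal_indicator intro!: nn_integral_cong split: split_indicator)
  also have "\<dots> = (\<integral>\<^sup>+t. indicator {0..d} t * (\<integral>\<^sup>+x. ennreal \<bar>f x\<bar> \<partial>lborel) \<partial>lborel)"
    using nn_integral_lborel_translate[of "\<lambda>x. ennreal \<bar>f x\<bar>"]
    by (simp add: nn_integral_cmult)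
  also have "\<dots> = emeasure lborel {0..d} * (\<integral>\<^sup>+x. ennreal \<bar>f x\<bar> \<partial>lborel)"
    by (simp add: nn_integral_multc)
  also have "\<dots> < \<infinity>"
    using f by (auto simp: integrable_iff_bounded emeasure_lborel_Icc_eq ennreal_mult_less_top)
  finally show ?thesis by (subst integrable_iff_bounded) auto
qed

lemma integrable_segment_integral:
  assumes "integrable lborel f"
  shows "integrable lborel (segment_integral d v f)"
  using lborel_pair.integrable_snd[OF integrable_pair_segment[OF assms]]
  unfolding segment_integral_def .

text \<open>
  Integration along segments in direction \<open>- v\<close> is the adjoint of integration along segments in
  direction \<open>v\<close>.
\<close>

lemma integral_mult_segment_integral:
  fixes f w :: "'a::euclidean_space \<Rightarrow> real"
  assumes f: "integrable lborel f" and w[measurable]: "w \<in> borel_measurable borel"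
    and bdd: "\<And>x. \<bar>w x\<bar> \<le> C"
  shows "(LINT x|lborel. f x * segment_integral d (- v) w x) = (LINT x|lborel. segment_integral d v f x * w x)"
proof -
  have [measurable]: "f \<in> borel_measurable borel" using f by auto
  have int1: "integrable (lborel \<Otimes>\<^sub>M lborel) (\<lambda>(t, x). indicator {0..d} t * f (x + t *\<^sub>R v) * w x)"
    using integrable_bounded_mult[OF integrable_pair_segment[OF f, of d v], of "\<lambda>z. w (snd z)" C] bdd
    by (simp add: case_prod_unfold mult_ac)
  have int2: "integrable (lborel \<Otimes>\<^sub>M lborel) (\<lambda>(t, x). indicator {0..d} t * f x * w (x - t *\<^sub>R v))"
    using integrable_bounded_mult[OF integrable_pair_segment[OF f, of d 0], of "\<lambda>z. w (snd z - fst z *\<^sub>R v)" C] bdd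
    by (simp add: case_prod_unfold mult_ac)
  have "(LINT x|lborel. f x * segment_integral d (- v) w x)
    = (LINT x|lborel. (LINT t|lborel. indicator {0..d} t * f x * w (x - t *\<^sub>R v)))"
    unfolding segment_integral_def
    by (subst integral_mult_right_zero[symmetric]) (simp add: mult_ac)
  also have "\<dots> = (LINT t|lborel. (LINT x|lborel. indicator {0..d} t * f x * w (x - t *\<^sub>R v)))"
    by (rule lborel_pair.Fubini_integral[OF int2])
  also have "\<dots> = (LINT t|lborel. (LINT x|lborel. indicator {0..d} t * f (x + t *\<^sub>R v) * w x))"
  proof (rule Bochner_Integration.integral_cong[OF refl])
    fix t :: real
    show "(LINT x|lborel. indicator {0..d} t * f x * w (x - t *\<^sub>R v)) =
      (LINT x|lborel. indicator {0..d} t * f (x + t *\<^sub>R v) * w x)"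
      using integral_lborel_translate[of "\<lambda>x. indicator {0..d} t * f x * w (x - t *\<^sub>R v)" "t *\<^sub>R v"] by simp
  qed
  also have "\<dots> = (LINT x|lborel. (LINT t|lborel. indicator {0..d} t * f (x + t *\<^sub>R v) * w x))"
    by (rule lborel_pair.Fubini_integral[OF int1, symmetric])
  also have "\<dots> = (LINT x|lborel. segment_integral d v f x * w x)"
    unfolding segment_integral_def by simp
  finally show ?thesis .
qed

section \<open>Derivatives of test functions\<close>

context
  fixes \<Omega> :: "'a::euclidean_space set" and \<phi> :: "'a \<Rightarrow> real"
  assumes \<phi>: "\<phi> \<in> test_functions \<Omega>"
begin

lemma test_function_has_derivative: "(\<phi> has_derivative frechet_derivative \<phi> (at x)) (at x)"
proof -
  have "C_k 1 \<phi>" using \<phi> by (auto simp: test_functions_def)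
  then show ?thesis using frechet_derivative_works by auto
qed

lemma test_function_continuous: "continuous_on S \<phi>"
  using \<phi> by (auto simp: test_functions_def intro: continuous_on_subset[of UNIV] dest!: spec[of _ 0])

lemma test_function_continuous_deriv:
  "b \<in> Basis \<Longrightarrow> continuous_on S (\<lambda>x. frechet_derivative \<phi> (at x) b)"
proof -
  assume b: "b \<in> Basis"
  have "C_k (Suc 0) \<phi>" using \<phi> by (auto simp: test_functions_def)
  then show ?thesis using b by (auto intro: continuous_on_subset[of UNIV])
qed

lemma test_function_borel: "\<phi> \<in> borel_measurable borel"
  using test_function_continuous by (rule borel_measurable_continuous_onI)

lemma test_function_deriv_borel:
  "b \<in> Basis \<Longrightarrow> (\<lambda>x. frechet_derivative \<phi> (at x) b) \<in> borel_measurable borel"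
  using test_function_continuous_deriv by (intro borel_measurable_continuous_onI)

lemma test_function_deriv_outside:
  assumes "x \<notin> closure {x. \<phi> x \<noteq> 0}"
  shows "frechet_derivative \<phi> (at x) = (\<lambda>h. 0)"
proof (rule frechet_derivative_eqI)
  have "((\<lambda>x. 0) has_derivative (\<lambda>h. 0)) (at x)" by simp
  then show "(\<phi> has_derivative (\<lambda>h. 0)) (at x)"
    by (rule has_derivative_transform_within_open[of _ _ _ _ "- closure {x. \<phi> x \<noteq> 0}"])
      (use assms closure_subset[of "{x. \<phi> x \<noteq> 0}"] in auto)
qed

lemma test_function_zero_outside:
  assumes "x \<notin> \<Omega>"
  shows "\<phi> x = 0" "frechet_derivative \<phi> (at x) b = 0"
proof -
  have "x \<notin> closure {x. \<phi> x \<noteq> 0}" using \<phi> assms by (auto simp: test_functions_def)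
  then show "\<phi> x = 0" "frechet_derivative \<phi> (at x) b = 0"
    using closure_subset[of "{x. \<phi> x \<noteq> 0}"] test_function_deriv_outside by auto
qed

lemma integrable_bounded_if_vanishing_off_support:
  assumes f: "continuous_on UNIV f" and zero: "\<And>x. x \<notin> closure {x. \<phi> x \<noteq> 0} \<Longrightarrow> f x = 0"
  shows "integrable lborel (f :: 'a \<Rightarrow> real)" "\<exists>C. \<forall>x. \<bar>f x\<bar> \<le> C"
proof -
  let ?K = "closure {x. \<phi> x \<noteq> 0}"
  have K: "compact ?K" using \<phi> by (simp add: test_functions_def)
  have fK: "continuous_on ?K f" using f continuous_on_subset by blast
  have "(\<lambda>x. indicator ?K x *\<^sub>R f x) = f"
    using zero by (auto simp: indicator_def fun_eq_iff)
  then show "integrable lborel f"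
    using borel_integrable_compact[OF K fK] by simp
  have "bounded (f ` ?K)" using compact_continuous_image[OF fK K] compact_imp_bounded by blast
  then obtain C where "\<forall>x\<in>?K. \<bar>f x\<bar> \<le> C" by (auto simp: bounded_iff)
  then have "\<bar>f x\<bar> \<le> max C 0" for x
    using zero[of x] by (cases "x \<in> ?K") (auto simp: le_max_iff_disj)
  then show "\<exists>C. \<forall>x. \<bar>f x\<bar> \<le> C" by blast
qed

lemma test_function_integrable: "integrable lborel \<phi>"
  by (rule integrable_bounded_if_vanishing_off_support) (use test_function_continuous closure_subset[of "{x. \<phi> x \<noteq> 0}"] in auto)

lemma test_function_bounded: "\<exists>C. \<forall>x. \<bar>\<phi> x\<bar> \<le> C"
  by (rule integrable_bounded_if_vanishing_off_support) (use test_function_continuous closure_subset[of "{x. \<phi> x \<noteq> 0}"] in auto)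

lemma test_function_deriv_integrable:
  "b \<in> Basis \<Longrightarrow> integrable lborel (\<lambda>x. frechet_derivative \<phi> (at x) b)"
  by (rule integrable_bounded_if_vanishing_off_support)
    (use test_function_continuous_deriv test_function_deriv_outside in auto)

lemma segment_integral_test_function_deriv:
  assumes b: "b \<in> Basis" and d: "0 \<le> d"
  shows "segment_integral d b (\<lambda>x. frechet_derivative \<phi> (at x) b) x = \<phi> (x + d *\<^sub>R b) - \<phi> x"
proof -
  have line: "((\<lambda>t. x + t *\<^sub>R b) has_derivative (\<lambda>s. s *\<^sub>R b)) (at t within {0..d})" for t
    by (auto intro!: derivative_eq_intros)
  have "((\<lambda>t. \<phi> (x + t *\<^sub>R b)) has_derivative (\<lambda>s. frechet_derivative \<phi> (at (x + t *\<^sub>R b)) (s *\<^sub>R b))) (at t within {0..d})" for t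
    by (rule has_derivative_compose[OF line test_function_has_derivative])
  moreover have "frechet_derivative \<phi> (at y) (s *\<^sub>R b) = s *\<^sub>R frechet_derivative \<phi> (at y) b" for y s
    using has_derivative_linear[OF test_function_has_derivative] by (rule linear_cmul)
  ultimately have der: "((\<lambda>t. \<phi> (x + t *\<^sub>R b)) has_vector_derivative frechet_derivative \<phi> (at (x + t *\<^sub>R b)) b) (at t within {0..d})" for t
    by (simp add: has_vector_derivative_def)
  have cont: "continuous_on {0..d} (\<lambda>t. frechet_derivative \<phi> (at (x + t *\<^sub>R b)) b)"
    by (rule continuous_on_compose2[OF test_function_continuous_deriv[OF b, of UNIV]])
      (auto intro!: continuous_intros)
  show ?thesis
    using integral_FTC_Icc[OF d der cont] by (simp add: segment_integral_def)
qed

text \<open>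
  The integral of a derivative over unit segments is a difference of translates of \<open>\<phi>\<close>, and
  the segment integral of the constant \<open>1\<close> is \<open>1\<close>.
\<close>

lemma integral_test_function_deriv_eq_0:
  assumes b: "b \<in> Basis"
  shows "(LINT x|lborel. frechet_derivative \<phi> (at x) b) = 0"
proof -
  have 1: "segment_integral 1 (- b) (\<lambda>x. 1) x = 1" for x
    by (simp add: segment_integral_def)
  have "(LINT x|lborel. frechet_derivative \<phi> (at x) b) =
    (LINT x|lborel. frechet_derivative \<phi> (at x) b * segment_integral 1 (- b) (\<lambda>x. 1) x)"
    by (simp add: 1)
  also have "\<dots> = (LINT x|lborel. segment_integral 1 b (\<lambda>x. frechet_derivative \<phi> (at x) b) x * 1)"
    by (rule integral_mult_segment_integral[where C = 1]) (use test_function_deriv_integrable[OF b] in auto)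
  also have "\<dots> = (LINT x|lborel. \<phi> (x + b) - \<phi> x)"
    by (simp add: segment_integral_test_function_deriv[OF b])
  also have "\<dots> = (LINT x|lborel. \<phi> (x + b)) - (LINT x|lborel. \<phi> x)"
  proof (rule Bochner_Integration.integral_diff)
    have "integrable (distr lborel borel ((+) b)) \<phi>"
      using test_function_integrable by (simp add: lborel_distr_plus)
    then show "integrable lborel (\<lambda>x. \<phi> (x + b))"
      using test_function_borel by (subst (asm) integrable_distr_eq) (auto simp: add.commute)
  qed (rule test_function_integrable)
  also have "\<dots> = 0" by (simp add: integral_lborel_translate test_function_borel)
  finally show ?thesis .
qed

end

lemma test_function_mult:
  assumes "\<phi> \<in> test_functions \<Omega>" "\<psi> \<in> test_functions \<Omega>"
  shows "(\<lambda>x. \<phi> x * \<psi> x) \<in> test_functions \<Omega>"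
proof -
  have sub: "closure {x. \<phi> x * \<psi> x \<noteq> 0} \<subseteq> closure {x. \<phi> x \<noteq> 0}"
    by (intro closure_mono) auto
  then have "compact (closure {x. \<phi> x * \<psi> x \<noteq> 0})"
    using assms unfolding test_functions_def
    by (metis (no_types, lifting) closed_closure compact_Int_closed inf.absorb_iff2 mem_Collect_eq)
  with sub assms show ?thesis by (auto simp: test_functions_def intro: C_k_mult)
qed

lemma weak_gradient_test_function:
  fixes \<phi> :: "'a::euclidean_space \<Rightarrow> real"
  assumes \<Omega>: "open \<Omega>" and \<phi>: "\<phi> \<in> test_functions \<Omega>" and g: "has_weak_gradient \<Omega> \<phi> g" and b: "b \<in> Basis"
  shows "AE x in lebesgue_on \<Omega>. g x \<bullet> b = frechet_derivative \<phi> (at x) b"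
proof -
  have \<Omega>b: "\<Omega> \<in> sets borel" using \<Omega> by auto
  have gi: "integrable (lebesgue_on \<Omega>) (\<lambda>x. g x \<bullet> b)"
    using g by (auto simp: has_weak_gradient_def)
  have int: "integrable (lebesgue_on \<Omega>) f" if "integrable lborel f" for f :: "'a \<Rightarrow> real"
  proof -
    have "integrable lebesgue f" using that by (simp add: integrable_completion)
    then show ?thesis using \<Omega>b
      by (subst integrable_restrict_space) (auto intro!: integrable_mult_indicator simp del: real_scaleR_def)
  qed
  have "AE x in lebesgue_on \<Omega>. g x \<bullet> b - frechet_derivative \<phi> (at x) b = 0"
  proof (rule fundamental_lemma_calculus_of_variations[OF \<Omega>])
    show "integrable (lebesgue_on \<Omega>) (\<lambda>x. g x \<bullet> b - frechet_derivative \<phi> (at x) b)"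
      using gi int[OF test_function_deriv_integrable[OF \<phi> b]] by auto
    fix \<psi> assume \<psi>: "\<psi> \<in> test_functions \<Omega>"
    note meas[measurable] = test_function_borel[OF \<phi>] test_function_borel[OF \<psi>]
      test_function_deriv_borel[OF \<phi> b] test_function_deriv_borel[OF \<psi> b]
    obtain C where C: "\<And>x. \<bar>\<psi> x\<bar> \<le> C" using test_function_bounded[OF \<psi>] by auto
    obtain D where D: "\<And>x. \<bar>\<phi> x\<bar> \<le> D" using test_function_bounded[OF \<phi>] by auto
    have i1: "integrable (lebesgue_on \<Omega>) (\<lambda>x. (g x \<bullet> b) * \<psi> x)"
      using integrable_bounded_mult[OF gi borel_measurable_lebesgue_onI[OF test_function_borel[OF \<psi>]] C]
      by (simp add: mult.commute)
    have i2: "integrable lborel (\<lambda>x. frechet_derivative \<phi> (at x) b * \<psi> x)"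
      using integrable_bounded_mult[OF test_function_deriv_integrable[OF \<phi> b] _ C] meas
      by (simp add: mult.commute)
    have i3: "integrable lborel (\<lambda>x. \<phi> x * frechet_derivative \<psi> (at x) b)"
      using integrable_bounded_mult[OF test_function_deriv_integrable[OF \<psi> b] _ D] meas
      by (simp add: mult.commute)
    have prod: "frechet_derivative (\<lambda>x. \<phi> x * \<psi> x) (at x) b =
      \<phi> x * frechet_derivative \<psi> (at x) b + frechet_derivative \<phi> (at x) b * \<psi> x" for x
      by (subst frechet_derivative_eqI[OF has_derivative_mult[OF test_function_has_derivative[OF \<phi>] test_function_has_derivative[OF \<psi>]]]) simp
    have "(LINT x|lebesgue_on \<Omega>. (g x \<bullet> b - frechet_derivative \<phi> (at x) b) * \<psi> x)
      = (LINT x|lebesgue_on \<Omega>. (g x \<bullet> b) * \<psi> x) - (LINT x|lebesgue_on \<Omega>. frechet_derivative \<phi> (at x) b * \<psi> x)"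
      using i1 int[OF i2] by (simp add: left_diff_distrib)
    also have "(LINT x|lebesgue_on \<Omega>. (g x \<bullet> b) * \<psi> x) = - (LINT x|lebesgue_on \<Omega>. \<phi> x * frechet_derivative \<psi> (at x) b)"
      using g \<psi> b by (simp add: has_weak_gradient_def)
    also have "(LINT x|lebesgue_on \<Omega>. \<phi> x * frechet_derivative \<psi> (at x) b) = (LINT x|lborel. \<phi> x * frechet_derivative \<psi> (at x) b)"
      by (rule integral_lebesgue_on_eq_lborel[OF \<Omega>b]) (auto simp: test_function_zero_outside[OF \<phi>])
    also have "(LINT x|lebesgue_on \<Omega>. frechet_derivative \<phi> (at x) b * \<psi> x) = (LINT x|lborel. frechet_derivative \<phi> (at x) b * \<psi> x)"
      by (rule integral_lebesgue_on_eq_lborel[OF \<Omega>b]) (auto simp: test_function_zero_outside[OF \<psi>])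
    also have "- (LINT x|lborel. \<phi> x * frechet_derivative \<psi> (at x) b) - (LINT x|lborel. frechet_derivative \<phi> (at x) b * \<psi> x)
      = - (LINT x|lborel. frechet_derivative (\<lambda>x. \<phi> x * \<psi> x) (at x) b)"
      using i2 i3 by (simp add: prod)
    also have "\<dots> = 0" using integral_test_function_deriv_eq_0[OF test_function_mult[OF \<phi> \<psi>] b] by simp
    finally show "(LINT x|lebesgue_on \<Omega>. (g x \<bullet> b - frechet_derivative \<phi> (at x) b) * \<psi> x) = 0" .
  qed
  then show ?thesis by eventually_elim simp
qed

section \<open>Weak closure of the test functions\<close>

lemma conjugate_fun_0_le:
  assumes "N_function B"
  shows "conjugate_fun B 0 \<le> 0"
  unfolding conjugate_fun_def using assms by (intro cSUP_least) (auto simp: N_function_def)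

lemma conjugate_fun_bdd_above:
  assumes B: "N_function B"
  shows "bdd_above ((\<lambda>t. t * s - B t) ` {0<..})"
proof -
  have "eventually (\<lambda>r. B r / r \<ge> s) at_top"
    using B by (simp add: N_function_def filterlim_at_top)
  then obtain R where R: "\<And>r. r \<ge> R \<Longrightarrow> B r / r \<ge> s" by (auto simp: eventually_at_top_linorder)
  have "t * s - B t \<le> max R 0 * \<bar>s\<bar>" if t: "t > 0" for t
  proof (cases "t \<ge> R")
    case True
    then have "t * s - B t \<le> 0" using R[of t] t by (simp add: field_simps)
    also have "0 \<le> max R 0 * \<bar>s\<bar>" by simp
    finally show ?thesis .
  next
    case False
    have "t * s \<le> t * \<bar>s\<bar>" using t by (intro mult_left_mono) auto
    moreover have "0 \<le> B t" using B t by (simp add: N_function_def)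
    ultimately have "t * s - B t \<le> t * \<bar>s\<bar>" by linarith
    also have "\<dots> \<le> max R 0 * \<bar>s\<bar>" using False by (intro mult_right_mono) auto
    finally show ?thesis .
  qed
  then show ?thesis by (intro bdd_aboveI2) auto
qed

lemma conjugate_fun_mono:
  assumes B: "N_function B" and "s \<le> s'"
  shows "conjugate_fun B s \<le> conjugate_fun B s'"
  unfolding conjugate_fun_def
  by (intro cSUP_mono conjugate_fun_bdd_above[OF B]) (use assms in \<open>auto intro!: bexI mult_left_mono\<close>)

text \<open>
  A bounded function is its own bounded approximation; what has to be shown is that it belongs to the
  Orlicz space of the conjugate function and that the Luxemburg norm of \<open>0\<close> is \<open>0\<close>.
\<close>

lemma bounded_borel_in_E_space:
  fixes \<Omega> :: "'a::euclidean_space set"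
  assumes \<Omega>: "bounded \<Omega>" "\<Omega> \<in> sets borel" and B: "N_function B"
    and w: "w \<in> borel_measurable borel" "\<And>x. \<bar>w x\<bar> \<le> C"
  shows "w \<in> E_space (conjugate_fun B) \<Omega>"
proof -
  have fin: "emeasure (lebesgue_on \<Omega>) \<Omega> < \<infinity>"
    using \<Omega> emeasure_bounded_finite[OF \<Omega>(1)] by (subst emeasure_restrict_space) auto
  have "(\<integral>\<^sup>+x. ennreal (conjugate_fun B \<bar>w x\<bar>) \<partial>lebesgue_on \<Omega>)
    \<le> (\<integral>\<^sup>+x. ennreal (conjugate_fun B C) \<partial>lebesgue_on \<Omega>)"
    by (intro nn_integral_mono ennreal_leI conjugate_fun_mono[OF B] w)
  also have "\<dots> < \<infinity>"
    using fin by (simp add: ennreal_mult_less_top)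
  finally have "w \<in> orlicz_class (conjugate_fun B) \<Omega>"
    using borel_measurable_lebesgue_onI[OF w(1)] by (simp add: orlicz_class_def)
  then have space: "w \<in> orlicz_space (conjugate_fun B) \<Omega>"
    unfolding orlicz_space_def
    by (intro CollectI exI[of _ "1::nat"] exI[of _ "\<lambda>_. 1"] exI[of _ "\<lambda>_. w"]) auto
  have "{l. 0 < l \<and> (\<integral>\<^sup>+x. ennreal (conjugate_fun B (\<bar>w x - w x\<bar> / l)) \<partial>lebesgue_on \<Omega>) \<le> 1} = {0<..}"
    using conjugate_fun_0_le[OF B] by (auto simp: ennreal_neg)
  then have "luxemburg_norm (conjugate_fun B) \<Omega> (\<lambda>x. w x - w x) = 0"
    unfolding luxemburg_norm_def by simp
  moreover have "bounded (w ` \<Omega>)" using w(2) by (auto simp: bounded_iff)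
  ultimately show ?thesis using space by (auto simp: E_space_def)
qed

lemma weak_grad_has_weak_gradient:
  "u \<in> W1B B \<Omega> \<Longrightarrow> has_weak_gradient \<Omega> u (weak_grad \<Omega> u)"
  unfolding weak_grad_def by (rule someI_ex[of "has_weak_gradient \<Omega> u"]) (simp add: W1B_def W11_def)

lemma W1B_0_subset_W1B: "W1B_0 B \<Omega> \<subseteq> W1B B \<Omega>"
proof -
  have "topspace (W1B_weak_topology B \<Omega>) \<subseteq> W1B B \<Omega>"
    unfolding W1B_weak_topology_def topology_generated_by_topspace
    by (rule Union_least) blast
  then show ?thesis
    unfolding W1B_0_def using closure_of_subset_topspace by (rule order_trans[rotated])
qed

text \<open>
  An identity between weakly continuous functionals extends from test functions to their closure.
\<close>

lemma W1B_0_linear_identity: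
  assumes u: "u \<in> W1B_0 B \<Omega>" and b: "b \<in> Basis"
    and w: "w \<in> E_space (conjugate_fun B) \<Omega>" and W: "W \<in> E_space (conjugate_fun B) \<Omega>"
    and test: "\<And>\<phi>. \<phi> \<in> test_functions \<Omega> \<Longrightarrow> \<phi> \<in> W1B B \<Omega> \<Longrightarrow>
      (LINT x|lebesgue_on \<Omega>. \<phi> x * w x) = - (LINT x|lebesgue_on \<Omega>. (weak_grad \<Omega> \<phi> x \<bullet> b) * W x)"
  shows "(LINT x|lebesgue_on \<Omega>. u x * w x) = - (LINT x|lebesgue_on \<Omega>. (weak_grad \<Omega> u x \<bullet> b) * W x)"
proof -
  define P where "P v = (LINT x|lebesgue_on \<Omega>. v x * w x)" for v
  define Q where "Q v = (LINT x|lebesgue_on \<Omega>. (weak_grad \<Omega> v x \<bullet> b) * W x)" for v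
  have "\<bar>P u + Q u\<bar> < e" if e: "e > 0" for e
  proof -
    define T where "T = {v \<in> W1B B \<Omega>. P v \<in> ball (P u) (e/2)} \<inter> {v \<in> W1B B \<Omega>. Q v \<in> ball (Q u) (e/2)}"
    have "openin (W1B_weak_topology B \<Omega>) {v \<in> W1B B \<Omega>. P v \<in> ball (P u) (e/2)}"
      unfolding W1B_weak_topology_def P_def
      by (rule topology_generated_by_Basis, rule UnI1) (use w in blast)
    moreover have "openin (W1B_weak_topology B \<Omega>) {v \<in> W1B B \<Omega>. Q v \<in> ball (Q u) (e/2)}"
      unfolding W1B_weak_topology_def Q_def
      by (rule topology_generated_by_Basis, rule UnI2) (use W b in blast)
    ultimately have "openin (W1B_weak_topology B \<Omega>) T" unfolding T_def by (rule openin_Int)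
    moreover have "u \<in> T" using u W1B_0_subset_W1B e by (auto simp: T_def)
    ultimately obtain \<phi> where \<phi>: "\<phi> \<in> test_functions \<Omega>" "\<phi> \<in> T"
      using u unfolding W1B_0_def in_closure_of by blast
    then have "P \<phi> = - Q \<phi>" using test[of \<phi>] by (auto simp: T_def P_def Q_def)
    moreover have "\<bar>P u - P \<phi>\<bar> < e / 2" "\<bar>Q u - Q \<phi>\<bar> < e / 2"
      using \<phi>(2) by (auto simp: T_def dist_real_def)
    ultimately show ?thesis by linarith
  qed
  from this[of "\<bar>P u + Q u\<bar>"] have "P u + Q u = 0" by auto
  then show ?thesis by (simp add: P_def Q_def)
qed

lemma abs_segment_integral_le:
  assumes "0 \<le> d" and w: "w \<in> borel_measurable borel" "\<And>x. \<bar>w x\<bar> \<le> C"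
  shows "\<bar>segment_integral d v w x\<bar> \<le> d * C"
proof -
  have C: "0 \<le> C" using w(2)[of 0] by linarith
  have int: "integrable lborel (\<lambda>t. C * indicator {0..d} t)"
    by (intro integrable_mult_right integrable_real_indicator) (simp_all add: emeasure_lborel_Icc_eq)
  have "\<bar>segment_integral d v w x\<bar> \<le> (LINT t|lborel. \<bar>indicator {0..d} t * w (x + t *\<^sub>R v)\<bar>)"
    unfolding segment_integral_def using integral_norm_bound[of lborel] by simp
  also have "\<dots> \<le> (LINT t|lborel. C * indicator {0..d} t)"
    by (rule integral_mono'[OF int]) (use w(2) C in \<open>auto simp: indicator_def\<close>)
  also have "\<dots> = d * C" using assms(1) by simp
  finally show ?thesis .
qed

text \<open>
  Elements of \<open>W1B_0\<close> vanish at the boundary in the sense that they are recovered from their gradient,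
  extended by zero, by integrating along segments that leave \<open>\<Omega>\<close>.
\<close>

lemma W1B_0_segment_representation:
  fixes \<Omega> :: "'a::euclidean_space set"
  assumes \<Omega>: "bounded \<Omega>" "open \<Omega>" and B: "N_function B" and u: "u \<in> W1B_0 B \<Omega>" and b: "b \<in> Basis"
    and d: "0 \<le> d" "\<And>x y. x \<in> \<Omega> \<Longrightarrow> y \<in> \<Omega> \<Longrightarrow> dist x y < d"
    and g: "integrable lborel g" "\<And>x. x \<notin> \<Omega> \<Longrightarrow> g x = 0" "AE x in lebesgue_on \<Omega>. weak_grad \<Omega> u x \<bullet> b = g x"
  shows "AE x in lebesgue_on \<Omega>. u x = - segment_integral d b g x"
proof -
  have \<Omega>b[measurable]: "\<Omega> \<in> sets borel" using \<Omega> by auto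
  have gm[measurable]: "g \<in> borel_measurable borel" using g(1) by auto
  have uW: "u \<in> W1B B \<Omega>" using u W1B_0_subset_W1B by blast
  then have "integrable (lebesgue_on \<Omega>) u" by (simp add: W1B_def W11_def)
  then obtain f where f[measurable]: "f \<in> borel_measurable borel" and f': "integrable lborel f"
      "\<And>x. x \<notin> \<Omega> \<Longrightarrow> f x = 0" "AE x in lebesgue_on \<Omega>. u x = f x"
    using integrable_lebesgue_on_borel_representative[OF \<Omega>b] by blast
  \<comment> \<open>this choice of \<open>w\<close> makes the integral of \<open>(f + segment_integral d b g) w\<close> the \<open>L\<^sup>1\<close> norm over \<open>\<Omega>\<close>\<close>
  define w where "w x = indicator \<Omega> x * sgn (f x + segment_integral d b g x)" for x
  have w[measurable]: "w \<in> borel_measurable borel" unfolding w_def by measurable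
  have w_bdd: "\<bar>w x\<bar> \<le> 1" for x by (auto simp: w_def indicator_def sgn_real_def)
  have w_out: "w x = 0" if "x \<notin> \<Omega>" for x using that by (simp add: w_def)
  define W where "W = segment_integral d (- b) w"
  have W[measurable]: "W \<in> borel_measurable borel" unfolding W_def by measurable
  have W_bdd: "\<bar>W x\<bar> \<le> d * 1" for x unfolding W_def by (rule abs_segment_integral_le[OF d(1) w w_bdd])
  have grad_int: "(LINT x|lebesgue_on \<Omega>. (weak_grad \<Omega> v x \<bullet> b) * W x) = (LINT x|lborel. segment_integral d b h x * w x)"
    if v: "v \<in> W1B B \<Omega>" and h: "integrable lborel h" "\<And>x. x \<notin> \<Omega> \<Longrightarrow> h x = 0"
      "AE x in lebesgue_on \<Omega>. weak_grad \<Omega> v x \<bullet> b = h x" for v h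
  proof -
    have [measurable]: "h \<in> borel_measurable borel" using h(1) by auto
    have meas: "(\<lambda>x. weak_grad \<Omega> v x \<bullet> b) \<in> borel_measurable (lebesgue_on \<Omega>)"
      using weak_grad_has_weak_gradient[OF v] by (auto simp: has_weak_gradient_def)
    have "(LINT x|lebesgue_on \<Omega>. (weak_grad \<Omega> v x \<bullet> b) * W x) = (LINT x|lebesgue_on \<Omega>. h x * W x)"
    proof (rule integral_cong_AE)
      show "AE x in lebesgue_on \<Omega>. (weak_grad \<Omega> v x \<bullet> b) * W x = h x * W x"
        using h(3) by eventually_elim simp
      show "(\<lambda>x. (weak_grad \<Omega> v x \<bullet> b) * W x) \<in> borel_measurable (lebesgue_on \<Omega>)"
        using meas borel_measurable_lebesgue_onI[OF W] by (rule borel_measurable_times)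
      show "(\<lambda>x. h x * W x) \<in> borel_measurable (lebesgue_on \<Omega>)"
        by (rule borel_measurable_lebesgue_onI) simp
    qed
    also have "\<dots> = (LINT x|lborel. h x * W x)"
      by (rule integral_lebesgue_on_eq_lborel) (use h in auto)
    also have "\<dots> = (LINT x|lborel. segment_integral d b h x * w x)"
      unfolding W_def by (rule integral_mult_segment_integral[OF h(1) w w_bdd])
    finally show ?thesis .
  qed
  have "(LINT x|lebesgue_on \<Omega>. u x * w x) = - (LINT x|lebesgue_on \<Omega>. (weak_grad \<Omega> u x \<bullet> b) * W x)"
  proof (rule W1B_0_linear_identity[OF u b])
    show "w \<in> E_space (conjugate_fun B) \<Omega>"
      by (rule bounded_borel_in_E_space[OF \<Omega>(1) \<Omega>b B w w_bdd])
    show "W \<in> E_space (conjugate_fun B) \<Omega>"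
      by (rule bounded_borel_in_E_space[OF \<Omega>(1) \<Omega>b B W W_bdd])
    fix \<phi> assume \<phi>: "\<phi> \<in> test_functions \<Omega>" "\<phi> \<in> W1B B \<Omega>"
    let ?h = "\<lambda>x. frechet_derivative \<phi> (at x) b"
    note [measurable] = test_function_borel[OF \<phi>(1)]
    have "(LINT x|lebesgue_on \<Omega>. (weak_grad \<Omega> \<phi> x \<bullet> b) * W x) = (LINT x|lborel. segment_integral d b ?h x * w x)"
      by (rule grad_int[OF \<phi>(2) test_function_deriv_integrable[OF \<phi>(1) b] test_function_zero_outside(2)[OF \<phi>(1)]
            weak_gradient_test_function[OF \<Omega>(2) \<phi>(1) weak_grad_has_weak_gradient[OF \<phi>(2)] b]])
    also have "\<dots> = (LINT x|lborel. - (\<phi> x * w x))"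
    proof (rule Bochner_Integration.integral_cong[OF refl])
      fix x
      show "segment_integral d b ?h x * w x = - (\<phi> x * w x)"
      proof (cases "x \<in> \<Omega>")
        case True
        have "x + d *\<^sub>R b \<notin> \<Omega>"
          using d(2)[OF True, of "x + d *\<^sub>R b"] b d(1) by (auto simp: dist_norm)
        then show ?thesis
          using test_function_zero_outside(1)[OF \<phi>(1)]
          by (simp add: segment_integral_test_function_deriv[OF \<phi>(1) b d(1)])
      qed (simp add: w_out)
    qed
    also have "\<dots> = - (LINT x|lebesgue_on \<Omega>. \<phi> x * w x)"
      by (subst integral_lebesgue_on_eq_lborel) (auto simp: w_out)
    finally show "(LINT x|lebesgue_on \<Omega>. \<phi> x * w x) = - (LINT x|lebesgue_on \<Omega>. (weak_grad \<Omega> \<phi> x \<bullet> b) * W x)"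
      by simp
  qed
  also have "(LINT x|lebesgue_on \<Omega>. (weak_grad \<Omega> u x \<bullet> b) * W x) = (LINT x|lborel. segment_integral d b g x * w x)"
    by (rule grad_int[OF uW g])
  also have "(LINT x|lebesgue_on \<Omega>. u x * w x) = (LINT x|lebesgue_on \<Omega>. f x * w x)"
  proof (rule integral_cong_AE)
    show "AE x in lebesgue_on \<Omega>. u x * w x = f x * w x"
      using f'(3) by eventually_elim simp
    show "(\<lambda>x. u x * w x) \<in> borel_measurable (lebesgue_on \<Omega>)"
      using uW borel_measurable_lebesgue_onI[OF w] by (auto simp: W1B_def W11_def)
    show "(\<lambda>x. f x * w x) \<in> borel_measurable (lebesgue_on \<Omega>)"
      by (rule borel_measurable_lebesgue_onI) simp
  qed
  also have "\<dots> = (LINT x|lborel. f x * w x)"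
    by (rule integral_lebesgue_on_eq_lborel) (auto simp: w_out)
  finally have eq: "(LINT x|lborel. f x * w x) = - (LINT x|lborel. segment_integral d b g x * w x)" .
  have i1: "integrable lborel (\<lambda>x. f x * w x)"
    using integrable_bounded_mult[OF f'(1) _ w_bdd] w by (simp add: mult.commute)
  have i2: "integrable lborel (\<lambda>x. segment_integral d b g x * w x)"
    using integrable_bounded_mult[OF integrable_segment_integral[OF g(1)] _ w_bdd] w by (simp add: mult.commute)
  have abs: "f x * w x + segment_integral d b g x * w x = indicator \<Omega> x * \<bar>f x + segment_integral d b g x\<bar>" for x
    by (simp add: w_def abs_sgn algebra_simps)
  have "(LINT x|lborel. indicator \<Omega> x * \<bar>f x + segment_integral d b g x\<bar>) = 0"
    using eq i1 i2 unfolding abs[symmetric] by simp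
  moreover have "integrable lborel (\<lambda>x. indicator \<Omega> x * \<bar>f x + segment_integral d b g x\<bar>)"
    unfolding abs[symmetric] using i1 i2 by simp
  ultimately have "AE x in lborel. indicator \<Omega> x * \<bar>f x + segment_integral d b g x\<bar> = 0"
    by (subst (asm) integral_nonneg_eq_0_iff_AE) auto
  then have "AE x in lebesgue_on \<Omega>. f x + segment_integral d b g x = 0"
    unfolding AE_lebesgue_on_iff_lborel[OF \<Omega>b] by eventually_elim (auto simp: indicator_def)
  then show ?thesis using f'(3) by eventually_elim simp
qed

section \<open>Hoelder and Gagliardo inequalities\<close>

lemma ennreal_powr_ennreal: "0 \<le> x \<Longrightarrow> ennreal_powr (ennreal x) p = ennreal (x powr p)"
  by (simp add: ennreal_powr_def)

lemma ennreal_powr_top [simp]: "ennreal_powr top p = top"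
  by (simp add: ennreal_powr_def)

lemma ennreal_powr_0 [simp]: "ennreal_powr 0 p = 0"
  by (simp add: ennreal_powr_def)

lemma ennreal_powr_eq_0_iff [simp]: "ennreal_powr x p = 0 \<longleftrightarrow> x = 0"
  by (cases x) (auto simp: ennreal_powr_def)

lemma ennreal_powr_mono:
  assumes "0 \<le> p" "x \<le> y"
  shows "ennreal_powr x p \<le> ennreal_powr y p"
  using assms by (cases x; cases y) (auto simp: ennreal_powr_def top_unique intro!: ennreal_leI powr_mono2)

lemma ennreal_powr_powr:
  "ennreal_powr (ennreal_powr x p) q = ennreal_powr x (p * q)"
  by (cases x) (auto simp: ennreal_powr_def powr_powr)

lemma ennreal_powr_one [simp]: "ennreal_powr x 1 = x"
  by (cases x) (auto simp: ennreal_powr_def)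

lemma prod_const_ennreal_powr:
  assumes "finite S" "S \<noteq> {}"
  shows "(\<Prod>i\<in>S. ennreal_powr x p) = ennreal_powr x (real (card S) * p)"
  using assms
proof (induction rule: finite_ne_induct)
  case (insert i S)
  then show ?case
    by (cases x) (auto simp: ennreal_powr_def powr_add algebra_simps ennreal_mult ennreal_mult_top simp flip: ennreal_mult)
qed simp

lemma borel_measurable_ennreal_powr [measurable]:
  assumes [measurable]: "f \<in> borel_measurable M"
  shows "(\<lambda>x. ennreal_powr (f x) p) \<in> borel_measurable M"
  unfolding ennreal_powr_def by measurable

lemma geometric_mean_le_arithmetic_mean:
  fixes x :: "'i \<Rightarrow> real"
  assumes S: "finite S" "S \<noteq> {}" and x: "\<And>i. i \<in> S \<Longrightarrow> 0 \<le> x i"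
  shows "(\<Prod>i\<in>S. x i powr (1 / card S)) \<le> (\<Sum>i\<in>S. x i) / card S"
proof (cases "\<exists>i\<in>S. x i = 0")
  case True
  then have "(\<Prod>i\<in>S. x i powr (1 / card S)) = 0" using S by (auto intro!: prod_zero)
  then show ?thesis using x by (simp add: sum_nonneg)
next
  case False
  then have pos: "x i > 0" if "i \<in> S" for i using x[OF that] that by force
  have card: "card S > 0" using S by (simp add: card_gt_0_iff)
  have "(\<Prod>i\<in>S. x i powr (1 / card S)) = exp (\<Sum>i\<in>S. (1 / card S) *\<^sub>R ln (x i))"
  proof (subst exp_sum[OF S(1)], intro prod.cong refl)
    fix i assume "i \<in> S"
    with pos[of i] show "x i powr (1 / card S) = exp ((1 / card S) *\<^sub>R ln (x i))"
      by (simp add: powr_def)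
  qed
  also have "\<dots> \<le> (\<Sum>i\<in>S. (1 / card S) * exp (ln (x i)))"
    by (rule convex_on_sum[OF _ _ exp_convex]) (use S card in auto)
  also have "\<dots> = (\<Sum>i\<in>S. x i) / card S"
    using pos by (simp add: sum_divide_distrib)
  finally show ?thesis .
qed

text \<open>
  Hoelder's inequality for finitely many functions with equal exponents. After normalising each
  integral to \<open>1\<close> it is the pointwise inequality between geometric and arithmetic mean; the cases of a
  vanishing or an infinite integral are treated separately.
\<close>

lemma Hoelder_nn_integral_prod:
  assumes S: "finite S" "S \<noteq> {}"
    and f[measurable]: "\<And>i. i \<in> S \<Longrightarrow> f i \<in> borel_measurable M"
  shows "(\<integral>\<^sup>+x. (\<Prod>i\<in>S. ennreal_powr (f i x) (1 / card S)) \<partial>M)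
    \<le> (\<Prod>i\<in>S. ennreal_powr (\<integral>\<^sup>+x. f i x \<partial>M) (1 / card S))"
proof -
  let ?p = "1 / real (card S)"
  have card: "card S > 0" using S by (simp add: card_gt_0_iff)
  consider i where "i \<in> S" "(\<integral>\<^sup>+x. f i x \<partial>M) = 0"
    | i where "i \<in> S" "(\<integral>\<^sup>+x. f i x \<partial>M) = \<infinity>" "\<And>i. i \<in> S \<Longrightarrow> (\<integral>\<^sup>+x. f i x \<partial>M) \<noteq> 0"
    | "\<And>i. i \<in> S \<Longrightarrow> (\<integral>\<^sup>+x. f i x \<partial>M) \<noteq> 0 \<and> (\<integral>\<^sup>+x. f i x \<partial>M) \<noteq> \<infinity>"
    by blast
  then show ?thesis
  proof cases
    case (1 i)
    then have "AE x in M. f i x = 0"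
      using f by (subst (asm) nn_integral_0_iff_AE) auto
    then have "AE x in M. (\<Prod>i\<in>S. ennreal_powr (f i x) ?p) = 0"
      by eventually_elim (use 1 S in \<open>auto intro!: prod_zero\<close>)
    then have "(\<integral>\<^sup>+x. (\<Prod>i\<in>S. ennreal_powr (f i x) ?p) \<partial>M) = 0"
      by (subst nn_integral_0_iff_AE) auto
    then show ?thesis by simp
  next
    case (2 i)
    have "(\<Prod>i\<in>S. ennreal_powr (\<integral>\<^sup>+x. f i x \<partial>M) ?p) = \<infinity>"
      using S 2 by (subst prod.remove[of _ i]) (auto simp: ennreal_top_mult)
    then show ?thesis by simp
  next
    case 3
    then have "\<forall>i\<in>S. \<exists>r>0. (\<integral>\<^sup>+x. f i x \<partial>M) = ennreal r"
      by (metis ennreal_cases ennreal_0 infinity_ennreal_def order_le_less)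
    then obtain a where a: "\<And>i. i \<in> S \<Longrightarrow> a i > 0" "\<And>i. i \<in> S \<Longrightarrow> (\<integral>\<^sup>+x. f i x \<partial>M) = ennreal (a i)"
      by metis
    \<comment> \<open>normalise: \<open>f i = a i * (f i / a i)\<close>, where \<open>f i / a i\<close> has integral \<open>1\<close>\<close>
    define C where "C = (\<Prod>i\<in>S. a i powr ?p)"
    have C: "C \<ge> 0" unfolding C_def by (intro prod_nonneg) auto
    have pw: "(\<Prod>i\<in>S. ennreal_powr (f i x) ?p) \<le> ennreal C * (\<Sum>i\<in>S. ennreal (1 / (card S * a i)) * f i x)" for x
    proof (cases "\<exists>i\<in>S. f i x = \<infinity>")
      case True
      then obtain i where i: "i \<in> S" "f i x = \<infinity>" by auto
      have "ennreal (1 / (card S * a i)) * f i x = \<infinity>"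
        using i a(1)[OF i(1)] card by (auto simp: ennreal_mult_eq_top_iff)
      then have "(\<Sum>i\<in>S. ennreal (1 / (card S * a i)) * f i x) = \<infinity>"
        using S i by (simp add: sum.remove)
      moreover have "C > 0" unfolding C_def using a by (intro prod_pos) (metis less_irrefl powr_gt_zero)
      ultimately show ?thesis by (simp add: ennreal_mult_eq_top_iff ennreal_mult_top)
    next
      case False
      define y where "y i = enn2real (f i x)" for i
      have y: "f i x = ennreal (y i)" "y i \<ge> 0" if "i \<in> S" for i
        using False that by (auto simp: y_def less_top)
      have "(\<Prod>i\<in>S. y i powr ?p) = C * (\<Prod>i\<in>S. (y i / a i) powr ?p)"
        unfolding C_def prod.distrib[symmetric]
      proof (intro prod.cong refl)
        fix i assume "i \<in> S"
        with a(1)[of i] y(2)[of i] show "y i powr ?p = a i powr ?p * (y i / a i) powr ?p"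
          by (simp add: powr_divide)
      qed
      also have "\<dots> \<le> C * ((\<Sum>i\<in>S. y i / a i) / card S)"
        by (intro mult_left_mono geometric_mean_le_arithmetic_mean S C divide_nonneg_nonneg y less_imp_le a)
      also have "\<dots> = C * (\<Sum>i\<in>S. 1 / (card S * a i) * y i)"
        by (simp add: sum_divide_distrib field_simps)
      finally have le: "(\<Prod>i\<in>S. y i powr ?p) \<le> C * (\<Sum>i\<in>S. 1 / (card S * a i) * y i)" .
      have "(\<Prod>i\<in>S. ennreal_powr (f i x) ?p) = ennreal (\<Prod>i\<in>S. y i powr ?p)"
        using y by (subst prod_ennreal[symmetric]) (auto simp: ennreal_powr_ennreal intro!: prod.cong)
      also have "\<dots> \<le> ennreal (C * (\<Sum>i\<in>S. 1 / (card S * a i) * y i))"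
        by (intro ennreal_leI le)
      also have "\<dots> = ennreal C * (\<Sum>i\<in>S. ennreal (1 / (card S * a i) * y i))"
        using y a C by (subst ennreal_mult) (auto intro!: sum_nonneg simp: sum_ennreal less_imp_le)
      also have "(\<Sum>i\<in>S. ennreal (1 / (card S * a i) * y i)) = (\<Sum>i\<in>S. ennreal (1 / (card S * a i)) * f i x)"
      proof (intro sum.cong refl)
        fix i assume "i \<in> S"
        with y[of i] a(1)[of i] show "ennreal (1 / (card S * a i) * y i) = ennreal (1 / (card S * a i)) * f i x"
          by (simp only: y(1)) (intro ennreal_mult, auto)
      qed
      finally show ?thesis .
    qed
    have "(\<integral>\<^sup>+x. (\<Prod>i\<in>S. ennreal_powr (f i x) ?p) \<partial>M)
      \<le> (\<integral>\<^sup>+x. ennreal C * (\<Sum>i\<in>S. ennreal (1 / (card S * a i)) * f i x) \<partial>M)"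
      by (intro nn_integral_mono pw)
    also have "\<dots> = ennreal C * (\<Sum>i\<in>S. ennreal (1 / (card S * a i)) * ennreal (a i))"
      using f by (simp add: nn_integral_cmult nn_integral_sum a(2) cong: sum.cong)
    also have "(\<Sum>i\<in>S. ennreal (1 / (card S * a i)) * ennreal (a i)) = (\<Sum>i\<in>S. ennreal (1 / card S))"
    proof (intro sum.cong refl)
      fix i assume "i \<in> S"
      then show "ennreal (1 / (card S * a i)) * ennreal (a i) = ennreal (1 / card S)"
        using a(1)[of i] by (subst ennreal_mult[symmetric]) auto
    qed
    also have "(\<Sum>i\<in>S. ennreal (1 / card S)) = 1"
      using card by (simp add: ennreal_of_nat_eq_real_of_nat flip: ennreal_mult)
    also have "ennreal C * 1 = (\<Prod>i\<in>S. ennreal_powr (\<integral>\<^sup>+x. f i x \<partial>M) ?p)"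
      unfolding C_def using a
      by (simp add: ennreal_powr_ennreal less_imp_le prod_ennreal[symmetric] cong: prod.cong)
    finally show ?thesis .
  qed
qed

text \<open>
  The integral of \<open>h\<close> over the affine subspace through \<open>x\<close> spanned by the directions in \<open>J\<close>, with respect
  to the product of one-dimensional Lebesgue measures. Starting from \<open>x\<close> itself instead of from its
  projection changes nothing, by translation invariance, and makes the value independent of the
  coordinates of \<open>x\<close> in \<open>J\<close>.
\<close>

definition integrate_dirs :: "'a::euclidean_space set \<Rightarrow> ('a \<Rightarrow> ennreal) \<Rightarrow> 'a \<Rightarrow> ennreal" where
  "integrate_dirs J h x = (\<integral>\<^sup>+y. h (x + (\<Sum>b\<in>J. y b *\<^sub>R b)) \<partial>(\<Pi>\<^sub>M b\<in>J. lborel))"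

interpretation lborel_product: product_sigma_finite "\<lambda>_. lborel :: real measure"
  by standard

lemma integrate_dirs_measurable [measurable]:
  assumes [measurable]: "h \<in> borel_measurable borel"
  shows "integrate_dirs J h \<in> borel_measurable borel"
proof (cases "finite J")
  case True
  interpret sigma_finite_measure "\<Pi>\<^sub>M b\<in>J. lborel :: real measure"
    using True by (rule lborel_product.sigma_finite)
  show ?thesis unfolding integrate_dirs_def by measurable
next
  case False
  then have "integrate_dirs J h = (\<lambda>x. h x * emeasure (\<Pi>\<^sub>M b\<in>J. lborel :: real measure) (space (\<Pi>\<^sub>M b\<in>J. lborel :: real measure)))"
    by (auto simp: integrate_dirs_def)
  then show ?thesis by simp
qed

lemma integrate_dirs_insert:
  fixes h :: "'a::euclidean_space \<Rightarrow> ennreal" and J :: "'a set"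
  assumes [measurable]: "h \<in> borel_measurable borel" and "finite J" "j \<notin> J"
  shows "integrate_dirs (insert j J) h x = (\<integral>\<^sup>+t. integrate_dirs J h (x + t *\<^sub>R j) \<partial>lborel)"
proof -
  have sum: "(\<Sum>b\<in>insert j J. (y(j := t)) b *\<^sub>R b) = t *\<^sub>R j + (\<Sum>b\<in>J. y b *\<^sub>R b)" for y :: "'a \<Rightarrow> real" and t
    using assms(2,3) by (simp, intro sum.cong) auto
  show ?thesis
    using assms(2,3) unfolding integrate_dirs_def
    by (subst lborel_product.product_nn_integral_insert_rev)
      (auto simp: sum add.assoc simp del: sum.insert fun_upd_apply)
qed

lemma integrate_dirs_empty [simp]: "integrate_dirs {} h x = h x"
  by (simp add: integrate_dirs_def space_PiM_empty)

lemma integrate_dirs_translate: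
  fixes h :: "'a::euclidean_space \<Rightarrow> ennreal"
  assumes [measurable]: "h \<in> borel_measurable borel" and "finite J" "j \<in> J"
  shows "integrate_dirs J h (x + t *\<^sub>R j) = integrate_dirs J h x"
proof -
  let ?K = "J - {j}"
  have J: "J = insert j ?K" using assms by auto
  have "integrate_dirs J h (x + t *\<^sub>R j) = (\<integral>\<^sup>+s. integrate_dirs ?K h (x + (t + 1 * s) *\<^sub>R j) \<partial>lborel)"
    using assms by (subst J, subst integrate_dirs_insert) (auto simp: algebra_simps)
  also have "\<dots> = (\<integral>\<^sup>+s. integrate_dirs ?K h (x + s *\<^sub>R j) \<partial>lborel)"
    using nn_integral_real_affine[of "\<lambda>s. integrate_dirs ?K h (x + s *\<^sub>R j)" 1 t] by simp
  also have "\<dots> = integrate_dirs J h x"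
    using assms by (subst (2) J, subst integrate_dirs_insert) auto
  finally show ?thesis .
qed

lemma integrate_dirs_Basis:
  fixes h :: "'a::euclidean_space \<Rightarrow> ennreal"
  assumes [measurable]: "h \<in> borel_measurable borel"
  shows "integrate_dirs Basis h x = (\<integral>\<^sup>+y. h y \<partial>lborel)"
proof -
  have "(\<integral>\<^sup>+y. h y \<partial>lborel) = (\<integral>\<^sup>+y. h y \<partial>distr lborel borel ((+) x))"
    by (simp add: lborel_distr_plus)
  also have "\<dots> = (\<integral>\<^sup>+y. h (x + y) \<partial>lborel)"
    by (simp add: nn_integral_distr)
  also have "\<dots> = integrate_dirs Basis h x"
    unfolding integrate_dirs_def
    by (subst lborel_eq) (simp add: nn_integral_distr)
  finally show ?thesis ..
qed

text \<open>
  Induction on \<open>J\<close>. When the direction \<open>j\<close> is added, the factor with \<open>i = j\<close> is constant along \<open>j\<close>, and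
  Hoelder's inequality applies to the remaining \<open>N - 1\<close> factors. Keeping one factor for each \<open>i \<in> Basis\<close>
  on the right-hand side, including the equal ones with \<open>i \<in> J\<close>, keeps all exponents equal.
\<close>

lemma integrate_prod_dirs_le:
  fixes h :: "'a::euclidean_space \<Rightarrow> ennreal"
  assumes [measurable]: "h \<in> borel_measurable borel" and dim: "DIM('a) \<ge> 2" and J: "J \<subseteq> Basis"
  defines "p \<equiv> 1 / (real DIM('a) - 1)"
  shows "integrate_dirs J (\<lambda>x. \<Prod>i\<in>Basis. ennreal_powr (integrate_dirs {i} h x) p) x
    \<le> (\<Prod>i\<in>Basis. ennreal_powr (integrate_dirs (insert i J) h x) p)"
proof -
  have "finite J" using J finite_Basis finite_subset by blast
  then show ?thesis using J
  proof (induction J arbitrary: x rule: finite_induct)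
    case empty
    then show ?case by simp
  next
    case (insert j J)
    let ?S = "Basis - {j} :: 'a set"
    let ?F = "\<lambda>x. \<Prod>i\<in>Basis. ennreal_powr (integrate_dirs {i} h x) p"
    have j: "j \<in> Basis" using insert by auto
    have card: "real (card ?S) = real DIM('a) - 1" "?S \<noteq> {}"
    proof -
      have c: "card ?S = DIM('a) - 1" using j by simp
      then show "real (card ?S) = real DIM('a) - 1" using dim by simp
      have "card ?S > 0" using c dim by simp
      then show "?S \<noteq> {}" by (metis card.empty less_irrefl)
    qed
    have "integrate_dirs (insert j J) ?F x = (\<integral>\<^sup>+t. integrate_dirs J ?F (x + t *\<^sub>R j) \<partial>lborel)"
      using insert by (intro integrate_dirs_insert) auto
    also have "\<dots> \<le> (\<integral>\<^sup>+t. (\<Prod>i\<in>Basis. ennreal_powr (integrate_dirs (insert i J) h (x + t *\<^sub>R j)) p) \<partial>lborel)"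
      using insert by (intro nn_integral_mono insert.IH) auto
    also have "\<dots> = (\<integral>\<^sup>+t. ennreal_powr (integrate_dirs (insert j J) h x) p *
        (\<Prod>i\<in>?S. ennreal_powr (integrate_dirs (insert i J) h (x + t *\<^sub>R j)) p) \<partial>lborel)"
      using insert j by (intro nn_integral_cong, subst prod.remove[of _ j]) (auto simp: integrate_dirs_translate)
    also have "\<dots> = ennreal_powr (integrate_dirs (insert j J) h x) p *
        (\<integral>\<^sup>+t. (\<Prod>i\<in>?S. ennreal_powr (integrate_dirs (insert i J) h (x + t *\<^sub>R j)) p) \<partial>lborel)"
      by (intro nn_integral_cmult) auto
    also have "\<dots> \<le> ennreal_powr (integrate_dirs (insert j J) h x) p *
        (\<Prod>i\<in>?S. ennreal_powr (\<integral>\<^sup>+t. integrate_dirs (insert i J) h (x + t *\<^sub>R j) \<partial>lborel) p)"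
      using Hoelder_nn_integral_prod[of ?S "\<lambda>i t. integrate_dirs (insert i J) h (x + t *\<^sub>R j)" lborel] card
      by (intro mult_left_mono) (auto simp: p_def)
    also have "(\<Prod>i\<in>?S. ennreal_powr (\<integral>\<^sup>+t. integrate_dirs (insert i J) h (x + t *\<^sub>R j) \<partial>lborel) p)
       = (\<Prod>i\<in>?S. ennreal_powr (integrate_dirs (insert i (insert j J)) h x) p)"
    proof (intro prod.cong refl)
      fix i assume i: "i \<in> ?S"
      then show "ennreal_powr (\<integral>\<^sup>+t. integrate_dirs (insert i J) h (x + t *\<^sub>R j) \<partial>lborel) p
        = ennreal_powr (integrate_dirs (insert i (insert j J)) h x) p"
        using insert.hyps by (subst insert_commute, subst integrate_dirs_insert) auto
    qed
    also have "ennreal_powr (integrate_dirs (insert j J) h x) p *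
        (\<Prod>i\<in>?S. ennreal_powr (integrate_dirs (insert i (insert j J)) h x) p) =
        (\<Prod>i\<in>Basis. ennreal_powr (integrate_dirs (insert i (insert j J)) h x) p)"
      using j by (subst (2) prod.remove[of _ j]) auto
    finally show ?case .
  qed
qed

text \<open>
  The Loomis-Whitney type inequality behind the Gagliardo-Nirenberg proof of the Sobolev inequality
  for \<open>W\<^sup>1\<^sup>,\<^sup>1\<close>.
\<close>

lemma Gagliardo_inequality:
  fixes h :: "'a::euclidean_space \<Rightarrow> ennreal"
  assumes [measurable]: "h \<in> borel_measurable borel" and dim: "DIM('a) \<ge> 2"
  shows "(\<integral>\<^sup>+x. (\<Prod>i\<in>Basis. ennreal_powr (\<integral>\<^sup>+t. h (x + t *\<^sub>R i) \<partial>lborel) (1 / (real DIM('a) - 1))) \<partial>lborel)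
    \<le> ennreal_powr (\<integral>\<^sup>+x. h x \<partial>lborel) (real DIM('a) / (real DIM('a) - 1))"
proof -
  have "(\<integral>\<^sup>+t. h (x + t *\<^sub>R i) \<partial>lborel) = integrate_dirs {i} h x" for x i
    by (subst integrate_dirs_insert) auto
  moreover have "(\<Prod>i\<in>(Basis::'a set). ennreal_powr (integrate_dirs (insert i Basis) h 0) p) =
      ennreal_powr (\<integral>\<^sup>+x. h x \<partial>lborel) (real DIM('a) * p)" for p
    by (simp add: insert_absorb integrate_dirs_Basis prod_const_ennreal_powr cong: prod.cong del: prod_constant)
  ultimately show ?thesis
    using integrate_prod_dirs_le[OF assms order_refl, of 0] by (simp add: integrate_dirs_Basis)
qed

section \<open>Jensen inequality and the Orlicz-Sobolev inequality\<close>

lemma N_function_0: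
  assumes "N_function B"
  shows "B 0 = 0"
proof -
  have lim: "((\<lambda>r. B r / r * r) \<longlongrightarrow> 0 * 0) (at_right 0)"
    using assms by (intro tendsto_mult) (auto simp: N_function_def)
  have "B 0 \<le> 0 * 0"
  proof (rule tendsto_lowerbound[OF lim])
    show "\<forall>\<^sub>F r in at_right 0. B 0 \<le> B r / r * r"
      by (rule eventually_at_rightI[of 0 1])
        (use assms in \<open>auto simp: N_function_def dest: strict_mono_onD[of _ _ 0] intro!: less_imp_le\<close>)
  qed simp
  then show ?thesis using assms by (force simp: N_function_def)
qed

lemma N_function_mono: "N_function B \<Longrightarrow> 0 \<le> x \<Longrightarrow> x \<le> y \<Longrightarrow> B x \<le> B y"
  using strict_mono_on_leD[of "{0..}" B x y] by (auto simp: N_function_def)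

lemma N_function_nonneg: "N_function B \<Longrightarrow> 0 \<le> x \<Longrightarrow> 0 \<le> B x"
  by (auto simp: N_function_def)

lemma N_function_abs_convex:
  assumes B: "N_function B"
  shows "convex_on UNIV (\<lambda>x. B \<bar>x\<bar>)"
proof (rule convex_onI)
  fix t x y :: real
  assume t: "0 < t" "t < 1"
  have "B \<bar>(1 - t) *\<^sub>R x + t *\<^sub>R y\<bar> \<le> B ((1 - t) *\<^sub>R \<bar>x\<bar> + t *\<^sub>R \<bar>y\<bar>)"
    using t by (intro N_function_mono[OF B]) (auto simp: abs_mult intro: order_trans[OF abs_triangle_ineq])
  also have "\<dots> \<le> (1 - t) * B \<bar>x\<bar> + t * B \<bar>y\<bar>"
    using B t by (intro convex_onD[of "{0..}" B]) (auto simp: N_function_def)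
  finally show "B \<bar>(1 - t) *\<^sub>R x + t *\<^sub>R y\<bar> \<le> (1 - t) * B \<bar>x\<bar> + t * B \<bar>y\<bar>" .
qed simp

lemma N_function_abs_borel:
  assumes B: "N_function B"
  shows "(\<lambda>x. B \<bar>x\<bar>) \<in> borel_measurable borel"
  by (intro borel_measurable_continuous_onI convex_on_continuous N_function_abs_convex[OF B]) simp

text \<open>
  No integrability is required of \<open>X\<close>: a Bochner integral that does not exist is \<open>0\<close>, and \<open>B 0 = 0\<close>. The
  right-hand side is enlarged from the segment to the whole line, so that it is constant along each
  line when \<open>X\<close> is the restriction of a function to that line.
\<close>

lemma Jensen_segment:
  fixes X :: "real \<Rightarrow> real"
  assumes B: "N_function B" and d: "d > 0" and X[measurable]: "X \<in> borel_measurable borel"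
  shows "ennreal (B (\<bar>LINT t|lborel. indicator {0..d} t * X t\<bar> / d))
    \<le> ennreal (1 / d) * (\<integral>\<^sup>+t. ennreal (B \<bar>X t\<bar>) \<partial>lborel)"
proof -
  let ?q = "\<lambda>x. B \<bar>x\<bar>"
  note [measurable] = N_function_abs_borel[OF B]
  \<comment> \<open>normalised Lebesgue measure on the segment\<close>
  define M where "M = density lborel (\<lambda>t. ennreal (indicator {0..d} t / d))"
  have setsM[measurable_cong]: "sets M = sets borel" by (simp add: M_def)
  interpret prob_space M
  proof
    have "emeasure M (space M) = (\<integral>\<^sup>+t. ennreal (1 / d) * indicator {0..d} t \<partial>lborel)"
      unfolding M_def using d by (subst emeasure_density) (auto intro!: nn_integral_cong simp: indicator_def)
    also have "\<dots> = 1"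
      using d by (simp add: nn_integral_cmult_indicator flip: ennreal_mult)
    finally show "emeasure M (space M) = 1" .
  qed
  have "expectation X = (LINT t|lborel. (indicator {0..d} t / d) * X t)"
    unfolding M_def using d by (subst integral_density) auto
  also have "\<dots> = (LINT t|lborel. indicator {0..d} t * X t) / d"
    by (simp flip: integral_divide_zero)
  finally have E: "\<bar>LINT t|lborel. indicator {0..d} t * X t\<bar> / d = \<bar>expectation X\<bar>"
    using d by simp
  have "(\<integral>\<^sup>+t. ennreal (?q (X t)) \<partial>M) = (\<integral>\<^sup>+t. ennreal (indicator {0..d} t / d) * ennreal (?q (X t)) \<partial>lborel)"
    unfolding M_def by (subst nn_integral_density) auto
  also have "\<dots> \<le> (\<integral>\<^sup>+t. ennreal (1 / d) * ennreal (?q (X t)) \<partial>lborel)"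
    using d by (intro nn_integral_mono mult_right_mono) (auto simp: indicator_def)
  also have "\<dots> = ennreal (1 / d) * (\<integral>\<^sup>+t. ennreal (?q (X t)) \<partial>lborel)"
    by (rule nn_integral_cmult) simp
  finally have le: "(\<integral>\<^sup>+t. ennreal (?q (X t)) \<partial>M) \<le> ennreal (1 / d) * (\<integral>\<^sup>+t. ennreal (?q (X t)) \<partial>lborel)" .
  consider "\<not> integrable M X" | "\<not> integrable M (\<lambda>t. ?q (X t))" | "integrable M X" "integrable M (\<lambda>t. ?q (X t))"
    by blast
  then have "ennreal (?q (expectation X)) \<le> (\<integral>\<^sup>+t. ennreal (?q (X t)) \<partial>M)"
  proof cases
    case 1
    then show ?thesis by (simp add: not_integrable_integral_eq N_function_0[OF B])
  next
    case 2
    have "(\<lambda>t. ?q (X t)) \<in> borel_measurable M" by measurable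
    then have "\<not> (\<integral>\<^sup>+t. ennreal (norm (?q (X t))) \<partial>M) < \<infinity>"
      using 2 unfolding integrable_iff_bounded by blast
    moreover have "norm (?q (X t)) = ?q (X t)" for t
      using N_function_nonneg[OF B, of "\<bar>X t\<bar>"] by simp
    ultimately have "(\<integral>\<^sup>+t. ennreal (?q (X t)) \<partial>M) = \<infinity>"
      by (simp only: less_top[symmetric] infinity_ennreal_def not_not)
    then show ?thesis by simp
  next
    case 3
    have "?q (expectation X) \<le> expectation (\<lambda>t. ?q (X t))"
      by (rule jensens_inequality[where I = UNIV]) (use 3 N_function_abs_convex[OF B] in auto)
    then have "ennreal (?q (expectation X)) \<le> ennreal (expectation (\<lambda>t. ?q (X t)))"
      by (rule ennreal_leI)
    also have "\<dots> = (\<integral>\<^sup>+t. ennreal (?q (X t)) \<partial>M)"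
      using 3 N_function_nonneg[OF B] by (subst nn_integral_eq_integral) auto
    finally show ?thesis .
  qed
  with le show ?thesis unfolding E by (rule order_trans[rotated])
qed

text \<open>
  The representation and Jensen's inequality bound \<open>B (\<bar>u x\<bar> / d)\<close> by the line integral of \<open>h\<close> through
  \<open>x\<close> in each coordinate direction; \<open>Gagliardo_inequality\<close> integrates the product of these bounds.
\<close>

lemma Orlicz_Sobolev_inequality:
  fixes \<Omega> :: "'a::euclidean_space set"
  assumes dim: "DIM('a) \<ge> 2" and p: "p = real DIM('a) / (real DIM('a) - 1)"
    and \<Omega>: "bounded \<Omega>" "open \<Omega>"
    and d: "0 < d" "\<And>x y. x \<in> \<Omega> \<Longrightarrow> y \<in> \<Omega> \<Longrightarrow> dist x y < d"
    and B: "N_function B" and u: "u \<in> W1B_0 B \<Omega>"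
  shows "ennreal_powr (\<integral>\<^sup>+x. ennreal (B (1 / d * \<bar>u x\<bar>) powr p) \<partial>lebesgue_on \<Omega>) (1 / p)
    \<le> ennreal (1 / d) * (\<integral>\<^sup>+x. ennreal (B (norm (weak_grad \<Omega> u x))) \<partial>lebesgue_on \<Omega>)"
proof -
  have \<Omega>b[measurable]: "\<Omega> \<in> sets borel" using \<Omega> by auto
  have uW: "u \<in> W1B B \<Omega>" using u W1B_0_subset_W1B by blast
  have p_pos: "p > 0" unfolding p using dim by simp
  let ?r = "1 / (real DIM('a) - 1)"
  have "\<forall>b. \<exists>g. g \<in> borel_measurable borel \<and> integrable lborel g \<and> (\<forall>x. x \<notin> \<Omega> \<longrightarrow> g x = 0) \<and>
      (AE x in lebesgue_on \<Omega>. weak_grad \<Omega> u x \<bullet> b = g x)"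
  proof
    fix b
    have "integrable (lebesgue_on \<Omega>) (\<lambda>x. weak_grad \<Omega> u x \<bullet> b)"
      using weak_grad_has_weak_gradient[OF uW] by (auto simp: has_weak_gradient_def)
    then show "\<exists>g. g \<in> borel_measurable borel \<and> integrable lborel g \<and> (\<forall>x. x \<notin> \<Omega> \<longrightarrow> g x = 0) \<and>
      (AE x in lebesgue_on \<Omega>. weak_grad \<Omega> u x \<bullet> b = g x)"
      by (rule integrable_lebesgue_on_borel_representative[OF \<Omega>b]) (intro exI conjI, auto)
  qed
  from choice[OF this] obtain g where g_all: "\<forall>b. g b \<in> borel_measurable borel \<and> integrable lborel (g b) \<and>
      (\<forall>x. x \<notin> \<Omega> \<longrightarrow> g b x = 0) \<and> (AE x in lebesgue_on \<Omega>. weak_grad \<Omega> u x \<bullet> b = g b x)" ..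
  then have g[measurable]: "\<And>b. g b \<in> borel_measurable borel" and g': "\<And>b. integrable lborel (g b)"
      "\<And>b x. x \<notin> \<Omega> \<Longrightarrow> g b x = 0" "\<And>b. AE x in lebesgue_on \<Omega>. weak_grad \<Omega> u x \<bullet> b = g b x"
    by simp_all
  \<comment> \<open>a Borel representative of the gradient, extended by zero\<close>
  define G where "G x = (\<Sum>b\<in>Basis. g b x *\<^sub>R b)" for x
  have G_meas[measurable]: "G \<in> borel_measurable borel" unfolding G_def by measurable
  have G_out: "G x = 0" if "x \<notin> \<Omega>" for x using that g' by (simp add: G_def)
  have g_le_G: "\<bar>g b x\<bar> \<le> norm (G x)" if "b \<in> Basis" for b x
  proof -
    have "g b x = G x \<bullet> b" using that by (simp add: G_def inner_sum_left inner_Basis if_distrib cong: if_cong)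
    then show ?thesis using Basis_le_norm[OF that] by simp
  qed
  have G_ae: "AE x in lebesgue_on \<Omega>. weak_grad \<Omega> u x = G x"
  proof -
    have "AE x in lebesgue_on \<Omega>. \<forall>b\<in>Basis. weak_grad \<Omega> u x \<bullet> b = g b x"
      using g'(3) by (intro AE_finite_allI) auto
    then show ?thesis
      by eventually_elim (metis (no_types, lifting) G_def euclidean_representation sum.cong)
  qed
  define h where "h x = ennreal (1 / d) * ennreal (B (norm (G x)))" for x
  have [measurable]: "(\<lambda>x. B (norm (G x))) \<in> borel_measurable borel"
    using measurable_compose[OF _ N_function_abs_borel[OF B], of "\<lambda>x. norm (G x)"] by simp
  have h[measurable]: "h \<in> borel_measurable borel" unfolding h_def by measurable
  have u_le: "AE x in lebesgue_on \<Omega>. \<forall>b\<in>Basis. ennreal (B (1 / d * \<bar>u x\<bar>)) \<le> (\<integral>\<^sup>+t. h (x + t *\<^sub>R b) \<partial>lborel)"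
  proof (intro AE_finite_allI finite_Basis)
    fix b :: 'a assume b: "b \<in> Basis"
    have "AE x in lebesgue_on \<Omega>. u x = - segment_integral d b (g b) x"
      using d g' by (intro W1B_0_segment_representation[OF \<Omega> B u b]) auto
    then show "AE x in lebesgue_on \<Omega>. ennreal (B (1 / d * \<bar>u x\<bar>)) \<le> (\<integral>\<^sup>+t. h (x + t *\<^sub>R b) \<partial>lborel)"
    proof eventually_elim
      case (elim x)
      have "ennreal (B (1 / d * \<bar>u x\<bar>)) = ennreal (B (\<bar>LINT t|lborel. indicator {0..d} t * g b (x + t *\<^sub>R b)\<bar> / d))"
        by (simp add: elim segment_integral_def)
      also have "\<dots> \<le> ennreal (1 / d) * (\<integral>\<^sup>+t. ennreal (B \<bar>g b (x + t *\<^sub>R b)\<bar>) \<partial>lborel)"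
        by (rule Jensen_segment[OF B d(1)]) simp
      also have "\<dots> \<le> ennreal (1 / d) * (\<integral>\<^sup>+t. ennreal (B (norm (G (x + t *\<^sub>R b)))) \<partial>lborel)"
        by (intro mult_left_mono nn_integral_mono ennreal_leI N_function_mono[OF B] g_le_G b) auto
      also have "\<dots> = (\<integral>\<^sup>+t. h (x + t *\<^sub>R b) \<partial>lborel)"
        unfolding h_def by (rule nn_integral_cmult[symmetric]) simp
      finally show ?case .
    qed
  qed
  have "(\<integral>\<^sup>+x. ennreal (B (1 / d * \<bar>u x\<bar>) powr p) \<partial>lebesgue_on \<Omega>)
    \<le> (\<integral>\<^sup>+x. (\<Prod>b\<in>Basis. ennreal_powr (\<integral>\<^sup>+t. h (x + t *\<^sub>R b) \<partial>lborel) ?r) \<partial>lebesgue_on \<Omega>)"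
  proof (rule nn_integral_mono_AE)
    show "AE x in lebesgue_on \<Omega>. ennreal (B (1 / d * \<bar>u x\<bar>) powr p)
        \<le> (\<Prod>b\<in>Basis. ennreal_powr (\<integral>\<^sup>+t. h (x + t *\<^sub>R b) \<partial>lborel) ?r)"
      using u_le
    proof eventually_elim
      case (elim x)
      let ?a = "ennreal (B (1 / d * \<bar>u x\<bar>))"
      have "ennreal (B (1 / d * \<bar>u x\<bar>) powr p) = ennreal_powr ?a (real DIM('a) * ?r)"
        using N_function_nonneg[OF B, of "1 / d * \<bar>u x\<bar>"] d(1) by (simp add: ennreal_powr_ennreal p)
      also have "\<dots> = (\<Prod>b\<in>(Basis::'a set). ennreal_powr ?a ?r)"
        by (rule prod_const_ennreal_powr[symmetric]) auto
      also have "\<dots> \<le> (\<Prod>b\<in>Basis. ennreal_powr (\<integral>\<^sup>+t. h (x + t *\<^sub>R b) \<partial>lborel) ?r)"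
        using elim dim by (intro prod_mono_ennreal ennreal_powr_mono) auto
      finally show ?case .
    qed
  qed
  also have "\<dots> \<le> (\<integral>\<^sup>+x. (\<Prod>b\<in>Basis. ennreal_powr (\<integral>\<^sup>+t. h (x + t *\<^sub>R b) \<partial>lborel) ?r) \<partial>lborel)"
    by (subst nn_integral_restrict_space) (auto simp: nn_integral_completion intro!: nn_integral_mono split: split_indicator)
  also have "\<dots> \<le> ennreal_powr (\<integral>\<^sup>+x. h x \<partial>lborel) p"
    unfolding p by (rule Gagliardo_inequality[OF h dim])
  finally have "ennreal_powr (\<integral>\<^sup>+x. ennreal (B (1 / d * \<bar>u x\<bar>) powr p) \<partial>lebesgue_on \<Omega>) (1 / p)
     \<le> ennreal_powr (ennreal_powr (\<integral>\<^sup>+x. h x \<partial>lborel) p) (1 / p)"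
    using p_pos by (intro ennreal_powr_mono) auto
  also have "\<dots> = (\<integral>\<^sup>+x. h x \<partial>lborel)"
    using p_pos by (simp add: ennreal_powr_powr)
  also have "\<dots> = ennreal (1 / d) * (\<integral>\<^sup>+x. ennreal (B (norm (G x))) \<partial>lborel)"
    unfolding h_def by (rule nn_integral_cmult) simp
  also have "(\<integral>\<^sup>+x. ennreal (B (norm (G x))) \<partial>lborel) = (\<integral>\<^sup>+x. ennreal (B (norm (G x))) \<partial>lebesgue_on \<Omega>)"
    by (rule nn_integral_lebesgue_on_eq_lborel[symmetric]) (auto simp: G_out N_function_0[OF B])
  also have "\<dots> = (\<integral>\<^sup>+x. ennreal (B (norm (weak_grad \<Omega> u x))) \<partial>lebesgue_on \<Omega>)"
    using G_ae by (intro nn_integral_cong_AE) (auto elim: eventually_mono)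
  finally show ?thesis .
qed

theorem proposition4p1:
  fixes \<Omega> :: "(real ^ 'n) set" and N' :: real
  assumes "CARD('n) \<ge> 2"
    and "N' = real CARD('n) / (real CARD('n) - 1)"
    and "bounded \<Omega>" and "lipschitz_domain \<Omega>"
  shows "\<exists>c\<^sub>1>0. \<exists>c\<^sub>2>0. \<forall>B. N_function B \<longrightarrow> (\<forall>u\<in>W1B_0 B \<Omega>.
           ennreal_powr (\<integral>\<^sup>+x. ennreal (B (c\<^sub>1 * \<bar>u x\<bar>) powr N') \<partial>lebesgue_on \<Omega>) (1 / N')
           \<le> ennreal c\<^sub>2 * (\<integral>\<^sup>+x. ennreal (B (norm (weak_grad \<Omega> u x))) \<partial>lebesgue_on \<Omega>))"
proof -
  define d where "d = diameter \<Omega> + 1"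
  have d_pos: "d > 0" using diameter_ge_0[OF assms(3)] by (simp add: d_def)
  have d: "dist x y < d" if "x \<in> \<Omega>" "y \<in> \<Omega>" for x y
    using diameter_bounded_bound[OF assms(3) that] by (simp add: d_def)
  have "open \<Omega>" using assms(4) by (simp add: lipschitz_domain_def)
  then have "\<forall>B. N_function B \<longrightarrow> (\<forall>u\<in>W1B_0 B \<Omega>.
           ennreal_powr (\<integral>\<^sup>+x. ennreal (B (1 / d * \<bar>u x\<bar>) powr N') \<partial>lebesgue_on \<Omega>) (1 / N')
           \<le> ennreal (1 / d) * (\<integral>\<^sup>+x. ennreal (B (norm (weak_grad \<Omega> u x))) \<partial>lebesgue_on \<Omega>))"
    using assms(1-3) d_pos d by (intro allI impI ballI Orlicz_Sobolev_inequality) simp_all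
  then show ?thesis using d_pos
    by (intro exI[of _ "1 / d"] conjI) simp_all
qed

end
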